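(* Let $\Omega$ be a finite set, $p_0\in\Delta(\Omega)$ a prior with full support, $A$ a compact set of actions, and $u_S,u_R:A\times\Omega\to\mathbb{R}$ continuous. Let $v(p)=\max_{P\in\mathcal{K}(\Omega):\,p\in P}U_S(\hat f_p(P),p)$ for $p\in\Delta(\Omega)$. Then the value of optimal ambiguous persuasion at prior $p_0$ is equal to $$\max_{\tau}\ \mathbb{E}_\tau[v(p)],$$ where the maximum is over (finitely supported) $\tau\in\Delta(\Delta(\Omega))$ subject to $\sum_{p\in\mathrm{supp}(\tau)}\tau(p)\,p=p_0$.
   Context: For a set $X$, $\Delta(X)$ is the space of probability distributions over $X$ with the weak topology. $\mathcal{K}(\Omega)$ is the set of all (nonempty) closed convex subsets of $\Delta(\Omega)$. For a receiver strategy $f\in\Delta(A)$, a belief $p\in\Delta(\Omega)$ and $i\in\{S,R\}$ (sender, receiver), write $U_i(f,p)=\int_A\sum_{\omega\in\Omega}u_i(a,\omega)p(\omega)\,df(a)$ (equal to $\sum_{a,\omega}f(a)u_i(a,\omega)p(\omega)$ when $f$ has finite support). Receiver's best responses: for $P\in\mathcal{K}(\Omega)$, $\bar f(P)=\arg\max_{f\in\Delta(A)}\min_{p\in P}U_R(f,p)$. For $p\in P$, $\hat f_p(P)\in\bar f(P)$ denotes a sender-preferred element at $p$, i.e. $U_S(\hat f_p(P),p)\ge U_S(f,p)$ for all $f\in\bar f(P)$. Devices: given a finite message space $M$, a probabilistic device is a map $\pi:\Omega\to\Delta(M)$, written $\pi(m|\omega)$; $\tau_\pi(m)=\sum_\omega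 p_0(\omega)\pi(m|\omega)$. An ambiguous device $\Pi$ is a closed and convex (nonempty) set of probabilistic devices on a common finite $M$ with common support: for all $\pi,\pi'\in\Pi$ and $m\in M$, $\tau_\pi(m)>0$ iff $\tau_{\pi'}(m)>0$. For $m$ with $\tau_\pi(m)>0$, the posterior is $p_m^\pi(\omega)=\pi(m|\omega)p_0(\omega)/\tau_\pi(m)$, and $P_m^\Pi=\{p_m^\pi:\pi\in\Pi\}\in\mathcal{K}(\Omega)$ is the receiver's set of posteriors (full Bayesian updating). The value (to the sender, a maxmin expected utility maximizer) of an ambiguous device $\Pi$ is $$\min_{\pi\in\Pi}\ \sum_{m:\tau_\pi(m)>0}\tau_\pi(m)\,U_S\big(\hat f_{p_m^\pi}(P_m^\Pi),p_m^\pi\big).$$ The value of optimal ambiguous persuasion at $p_0$ is the supremum of the values of all ambiguous devices, over all finite message spaces. *)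

theory Defs
  imports "HOL-Probability.Probability"
begin

text \<open>
  The finite state space is the type \<open>'w\<close>, and beliefs are vectors in \<open>real ^ 'w\<close>. As the simplex is
  closed and bounded there, its (weakly) closed subsets are the closed, hence compact, sets of
  vectors contained in it.
\<close>

definition beliefs :: "(real ^ 'w::finite) set" where
  "beliefs = {p. (\<forall>\<omega>. 0 \<le> p $ \<omega>) \<and> (\<Sum>\<omega>\<in>UNIV. p $ \<omega>) = 1}"

definition belief_sets :: "(real ^ 'w::finite) set set" where
  "belief_sets = {P. P \<noteq> {} \<and> closed P \<and> convex P \<and> P \<subseteq> beliefs}"

text \<open>Mixed actions are Borel probability measures on the subspace \<open>A\<close>.\<close>

definition strategies :: "'a::topological_space set \<Rightarrow> 'a measure set" where
  "strategies A = {f. prob_space f \<and> sets f = sets (restrict_space borel A)}"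

definition exp_utility ::
    "('a \<Rightarrow> 'w \<Rightarrow> real) \<Rightarrow> 'a measure \<Rightarrow> real ^ 'w::finite \<Rightarrow> real" where
  "exp_utility u f p = (\<integral>a. (\<Sum>\<omega>\<in>UNIV. u a \<omega> * p $ \<omega>) \<partial>f)"

text \<open>The infimum is a minimum: \<open>P\<close> is compact and the utility is linear in the belief.\<close>

definition best_responses ::
    "'a::topological_space set \<Rightarrow> ('a \<Rightarrow> 'w \<Rightarrow> real) \<Rightarrow> (real ^ 'w::finite) set \<Rightarrow> 'a measure set" where
  "best_responses A uR P =
     {f. is_arg_max (\<lambda>f. INF p\<in>P. exp_utility uR f p) (\<lambda>f. f \<in> strategies A) f}"

text \<open>
  The constant \<open>arg_max\<close> picks an arbitrary maximiser. All maximisers give the sender the same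
  utility at \<open>p\<close>, so the choice does not affect the values defined below.
\<close>

definition sender_preferred ::
    "'a::topological_space set \<Rightarrow> ('a \<Rightarrow> 'w \<Rightarrow> real) \<Rightarrow> ('a \<Rightarrow> 'w \<Rightarrow> real)
      \<Rightarrow> real ^ 'w::finite \<Rightarrow> (real ^ 'w) set \<Rightarrow> 'a measure" where
  "sender_preferred A uS uR p P =
     arg_max (\<lambda>f. exp_utility uS f p) (\<lambda>f. f \<in> best_responses A uR P)"

definition sender_utility ::
    "'a::topological_space set \<Rightarrow> ('a \<Rightarrow> 'w \<Rightarrow> real) \<Rightarrow> ('a \<Rightarrow> 'w \<Rightarrow> real)
      \<Rightarrow> (real ^ 'w::finite) set \<Rightarrow> real ^ 'w \<Rightarrow> real" where
  "sender_utility A uS uR P p = exp_utility uS (sender_preferred A uS uR p P) p"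

text \<open>
  Every finite message space is, up to relabelling, a finite set \<open>M\<close> of natural numbers. A device
  \<open>\<pi>\<close> assigns to the state \<open>\<omega>\<close> the probabilities \<open>\<pi> \<omega> m\<close>, which are extended by \<open>0\<close> outside \<open>M\<close>; so
  closedness in the product topology on \<open>'w \<Rightarrow> nat \<Rightarrow> real\<close> coincides with closedness in the
  finite-dimensional space of functions on \<open>'w \<times> M\<close>.
\<close>

definition devices :: "nat set \<Rightarrow> ('w \<Rightarrow> nat \<Rightarrow> real) set" where
  "devices M = {\<pi>. \<forall>\<omega>. (\<forall>m. 0 \<le> \<pi> \<omega> m) \<and> (\<forall>m. m \<notin> M \<longrightarrow> \<pi> \<omega> m = 0) \<and> (\<Sum>m\<in>M. \<pi> \<omega> m) = 1}"

definition message_prob :: "real ^ 'w::finite \<Rightarrow> ('w \<Rightarrow> nat \<Rightarrow> real) \<Rightarrow> nat \<Rightarrow> real" where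
  "message_prob p0 \<pi> m = (\<Sum>\<omega>\<in>UNIV. p0 $ \<omega> * \<pi> \<omega> m)"

definition posterior :: "real ^ 'w::finite \<Rightarrow> ('w \<Rightarrow> nat \<Rightarrow> real) \<Rightarrow> nat \<Rightarrow> real ^ 'w" where
  "posterior p0 \<pi> m = (\<chi> \<omega>. \<pi> \<omega> m * p0 $ \<omega> / message_prob p0 \<pi> m)"

text \<open>
  Convexity is spelled out because the function type is not an instance of the class of real vector
  spaces.
\<close>

definition ambiguous_device ::
    "real ^ 'w::finite \<Rightarrow> nat set \<Rightarrow> ('w \<Rightarrow> nat \<Rightarrow> real) set \<Rightarrow> bool" where
  "ambiguous_device p0 M D \<longleftrightarrow>
     finite M \<and> D \<noteq> {} \<and> D \<subseteq> devices M \<and> closed D \<and>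
     (\<forall>\<pi>\<in>D. \<forall>\<pi>'\<in>D. \<forall>t\<in>{0..1}. (\<lambda>\<omega> m. (1 - t) * \<pi> \<omega> m + t * \<pi>' \<omega> m) \<in> D) \<and>
     (\<forall>\<pi>\<in>D. \<forall>\<pi>'\<in>D. \<forall>m\<in>M. message_prob p0 \<pi> m > 0 \<longleftrightarrow> message_prob p0 \<pi>' m > 0)"

definition posterior_set ::
    "real ^ 'w::finite \<Rightarrow> ('w \<Rightarrow> nat \<Rightarrow> real) set \<Rightarrow> nat \<Rightarrow> (real ^ 'w) set" where
  "posterior_set p0 D m = (\<lambda>\<pi>. posterior p0 \<pi> m) ` D"

text \<open>
  The infimum is a minimum: \<open>D\<close> is compact, and the objective is continuous on it because, by
  common support, the sum ranges over the same messages for every element of \<open>D\<close>.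
\<close>

definition device_value ::
    "'a::topological_space set \<Rightarrow> ('a \<Rightarrow> 'w \<Rightarrow> real) \<Rightarrow> ('a \<Rightarrow> 'w \<Rightarrow> real)
      \<Rightarrow> real ^ 'w::finite \<Rightarrow> nat set \<Rightarrow> ('w \<Rightarrow> nat \<Rightarrow> real) set \<Rightarrow> real" where
  "device_value A uS uR p0 M D =
     (INF \<pi>\<in>D. \<Sum>m | m \<in> M \<and> message_prob p0 \<pi> m > 0.
        message_prob p0 \<pi> m * sender_utility A uS uR (posterior_set p0 D m) (posterior p0 \<pi> m))"

definition optimal_ambiguous_value ::
    "'a::topological_space set \<Rightarrow> ('a \<Rightarrow> 'w \<Rightarrow> real) \<Rightarrow> ('a \<Rightarrow> 'w \<Rightarrow> real)
      \<Rightarrow> real ^ 'w::finite \<Rightarrow> real" where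
  "optimal_ambiguous_value A uS uR p0 =
     Sup {device_value A uS uR p0 M D | M D. ambiguous_device p0 M D}"

text \<open>The function \<open>v\<close>; that this supremum is attained is not part of the definition.\<close>

definition best_value ::
    "'a::topological_space set \<Rightarrow> ('a \<Rightarrow> 'w \<Rightarrow> real) \<Rightarrow> ('a \<Rightarrow> 'w \<Rightarrow> real)
      \<Rightarrow> real ^ 'w::finite \<Rightarrow> real" where
  "best_value A uS uR p = (SUP P\<in>{P \<in> belief_sets. p \<in> P}. sender_utility A uS uR P p)"

definition splittings :: "real ^ 'w::finite \<Rightarrow> (real ^ 'w) pmf set" where
  "splittings p0 =
     {\<tau>. finite (set_pmf \<tau>) \<and> set_pmf \<tau> \<subseteq> beliefs \<and> (\<Sum>p\<in>set_pmf \<tau>. pmf \<tau> p *\<^sub>R p) = p0}"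

end

(*
  Since payoffs are linear in beliefs, only the compact convex set K of pairs of payoff vectors
  generated by mixed actions matters. By the minimax theorem, k in K is a best response to P iff it
  forms a saddle point with some q in P, and then it is still a best response to the segment
  from p to q. Hence v(p) is a maximum over a compact set of triples (p, k, q), and the graph of
  such values has a compact convex hull, whose top point above p0 gives the optimal splitting.
  Any single device of an ambiguous device splits p0, which bounds its value by this top point.
  Conversely, each posterior p of an optimal splitting is announced by two synonyms; the
  ambiguous device is the segment between two devices in which one synonym or the other has, with
  tiny probability, the pessimistic posterior q. This makes [p, q] the set of posteriors of both
  synonyms at vanishing cost.
*)

theory Submission
  imports Defs
begin

section \<open>Saddle points of the bilinear maximin problem\<close>

text \<open>Two topologies are avoided. Mixed actions enter only through a vector-valued integral,
  so \<open>strategies A\<close> needs no topology; the payoffs come in pairs because the receiver's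
  component decides which responses are best and the sender's component breaks ties.
  \<open>belief_sets\<close> needs no topology either: a saddle point replaces the dependence on a
  whole set of beliefs by closed conditions on a single belief.

  The sender is cautious too, so the ambiguity that steers the receiver might hurt the sender as
  well. The synonyms prevent this: along the segment of devices, mass only moves between the two
  synonyms of a posterior, their total joint mass stays fixed, and the same response is available
  after both. Its payoff is linear in the joint mass, so the sender's lower bound is the same at
  every element of the device.\<close>

lemma compact_bdd_below_inner:
  fixes P :: "'b::euclidean_space set"
  assumes "compact P"
  shows "bdd_below ((\<lambda>p. r \<bullet> p) ` P)"
  by (intro bounded_imp_bdd_below compact_imp_bounded compact_continuous_image
      continuous_intros assms)

text \<open>An infimum of linear functionals of norm at most \<open>B\<close> is
  \<open>B\<close>-Lipschitz, hence attains its maximum on the compact set \<open>K\<close>.\<close>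

lemma maximin_attained:
  fixes K P :: "'b::euclidean_space set"
  assumes "compact K" "K \<noteq> {}" "compact P" "P \<noteq> {}"
  obtains r where "r \<in> K" "\<And>r'. r' \<in> K \<Longrightarrow> (INF p\<in>P. r' \<bullet> p) \<le> (INF p\<in>P. r \<bullet> p)"
proof -
  define g where "g r = (INF p\<in>P. r \<bullet> p)" for r
  obtain B where B: "\<And>p. p \<in> P \<Longrightarrow> norm p \<le> B"
    using compact_imp_bounded[OF \<open>compact P\<close>] bounded_iff by blast
  have le: "g r \<le> g r' + B * norm (r - r')" for r r'
  proof -
    have "g r - B * norm (r - r') \<le> g r'"
      unfolding g_def[of r']
    proof (rule cINF_greatest)
      fix p assume "p \<in> P"
      then have "g r \<le> r \<bullet> p"
        unfolding g_def by (intro cINF_lower compact_bdd_below_inner assms)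
      moreover have "r \<bullet> p - r' \<bullet> p \<le> norm (r - r') * norm p"
        using norm_cauchy_schwarz[of "r - r'" p] by (simp add: inner_diff_left)
      moreover have "norm (r - r') * norm p \<le> norm (r - r') * B"
        using B[OF \<open>p \<in> P\<close>] by (intro mult_left_mono) auto
      ultimately show "g r - B * norm (r - r') \<le> r' \<bullet> p" by (simp add: mult.commute)
    qed (use assms in auto)
    then show ?thesis by simp
  qed
  have "0 \<le> B" using B assms(4) norm_ge_zero order_trans by (metis equals0I)
  then have "B-lipschitz_on UNIV g"
  proof (intro lipschitz_onI)
    fix r r'
    show "dist (g r) (g r') \<le> B * dist r r'"
      using le[of r r'] le[of r' r] by (auto simp: dist_norm norm_minus_commute abs_le_iff)
  qed
  then have "continuous_on K g"
    by (meson continuous_on_subset lipschitz_on_continuous_on subset_UNIV)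
  then show thesis
    using continuous_attains_sup[OF assms(1,2)] that unfolding g_def by blast
qed

text \<open>Minimax by separation: a hyperplane divides \<open>K\<close> from the vectors that
  guarantee more than the maximin value \<open>V\<close>, and its normal turns out to be a positive
  multiple of some \<open>q\<close> in \<open>P\<close>. The vector \<open>e\<close> (all ones in
  the application) supplies \<open>V *\<^sub>R e\<close>, which pays exactly \<open>V\<close>
  against every belief.\<close>

lemma saddle_point_exists:
  fixes K P :: "'b::euclidean_space set"
  assumes K: "compact K" "convex K" "K \<noteq> {}" and P: "compact P" "convex P" "P \<noteq> {}"
    and e: "\<And>p. p \<in> P \<Longrightarrow> e \<bullet> p = 1"
  obtains r q where "r \<in> K" "q \<in> P" "\<And>r'. r' \<in> K \<Longrightarrow> r' \<bullet> q \<le> r \<bullet> q"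
    "\<And>p. p \<in> P \<Longrightarrow> r \<bullet> q \<le> r \<bullet> p" "\<And>p. p \<in> P \<Longrightarrow> r \<bullet> q = (INF p\<in>P. r \<bullet> p)"
proof -
  obtain r where r: "r \<in> K" "\<And>r'. r' \<in> K \<Longrightarrow> (INF p\<in>P. r' \<bullet> p) \<le> (INF p\<in>P. r \<bullet> p)"
    using maximin_attained[OF K(1,3) P(1,3)] by blast
  define V where "V = (INF p\<in>P. r \<bullet> p)"
  have V: "V \<le> r \<bullet> p" if "p \<in> P" for p
    unfolding V_def by (intro cINF_lower compact_bdd_below_inner P that)
  define D where "D = {x. \<forall>p\<in>P. V < x \<bullet> p}"
  have "D = (\<Inter>p\<in>P. {x. V < p \<bullet> x})" by (auto simp: D_def inner_commute)
  then have "convex D" by (simp add: convex_INT convex_halfspace_gt)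
  moreover have inD: "V *\<^sub>R e + d \<in> D" if "\<And>p. p \<in> P \<Longrightarrow> 0 < d \<bullet> p" for d
    using that e by (auto simp: D_def inner_add_left)
  moreover have "K \<inter> D = {}"
  proof (rule equals0I)
    fix x assume x: "x \<in> K \<inter> D"
    \<comment> \<open>The infimum is attained on the compact set \<open>P\<close>, so the strict
      inequality defining \<open>D\<close> survives and would beat the maximin value.\<close>
    obtain p where "p \<in> P" "\<And>p'. p' \<in> P \<Longrightarrow> x \<bullet> p \<le> x \<bullet> p'"
      using continuous_attains_inf[OF P(1,3), of "\<lambda>p. x \<bullet> p"]
        continuous_on_inner[OF continuous_on_const continuous_on_id] by blast
    then have "x \<bullet> p \<le> (INF p\<in>P. x \<bullet> p)" using P by (intro cINF_greatest) auto
    with r(2)[of x] x \<open>p \<in> P\<close> show False unfolding D_def V_def by force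
  qed
  moreover have "D \<noteq> {}" using inD[of e] e by auto
  ultimately obtain a b where ab: "a \<noteq> 0" "\<And>x. x \<in> K \<Longrightarrow> a \<bullet> x \<le> b" "\<And>x. x \<in> D \<Longrightarrow> b \<le> a \<bullet> x"
    using separating_hyperplane_sets[OF K(2) \<open>convex D\<close> K(3)] by metis
  \<comment> \<open>Large \<open>t\<close> will show that \<open>a\<close> is nonnegative on every
    \<open>d\<close> that is positive on \<open>P\<close>; small \<open>t\<close> with
    \<open>d = e\<close> will bound \<open>b\<close> by \<open>V * c\<close>.\<close>
  have shift: "b \<le> V * (a \<bullet> e) + t * (a \<bullet> d)" if "\<And>p. p \<in> P \<Longrightarrow> 0 < d \<bullet> p" "0 < t" for d t
    using ab(3)[OF inD[of "t *\<^sub>R d"]] that by (simp add: inner_add_right)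
  have pos: "0 \<le> a \<bullet> d" if d: "\<And>p. p \<in> P \<Longrightarrow> 0 < d \<bullet> p" for d
  proof (rule ccontr)
    assume "\<not> 0 \<le> a \<bullet> d"
    then have neg: "a \<bullet> d < 0" by simp
    define t where "t = (\<bar>b - V * (a \<bullet> e)\<bar> + 1) / - (a \<bullet> d)"
    have "0 < t" "t * (a \<bullet> d) = - (\<bar>b - V * (a \<bullet> e)\<bar> + 1)" using neg by (auto simp: t_def field_simps)
    then show False using shift[OF d \<open>0 < t\<close>] by simp
  qed
  \<comment> \<open>The conic hull of a compact set that avoids the origin is closed, so a point
    outside it can be strictly separated.\<close>
  have "0 \<notin> P" using e by fastforce
  define C where "C = conic hull P"
  have C: "closed C" "convex C" unfolding C_def
    using P \<open>0 \<notin> P\<close> by (auto intro: closed_conic_hull convex_conic_hull)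
  have "a \<in> C"
  proof (rule ccontr)
    assume "a \<notin> C"
    then obtain d c where d: "d \<bullet> a < c" "\<And>x. x \<in> C \<Longrightarrow> c < d \<bullet> x"
      using separating_hyperplane_closed_point[OF C(2,1)] by blast
    have "0 \<in> C" using P by (auto simp: C_def conic_hull_contains_0)
    then have "c < 0" using d(2) by force
    have "0 \<le> d \<bullet> p" if "p \<in> P" for p
    proof (rule ccontr)
      assume "\<not> 0 \<le> d \<bullet> p"
      then have "(c / (d \<bullet> p)) *\<^sub>R p \<in> C" using \<open>c < 0\<close> that
        by (auto simp: C_def conic_hull_explicit divide_nonpos_neg intro!: exI[of _ "c / (d \<bullet> p)"] exI[of _ p])
      from d(2)[OF this] \<open>\<not> 0 \<le> d \<bullet> p\<close> show False by simp
    qed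
    then have *: "0 \<le> a \<bullet> (d + s *\<^sub>R e)" if "0 < s" for s
      using that e by (intro pos) (auto simp: inner_add_left intro: add_nonneg_pos)
    \<comment> \<open>The separating \<open>d\<close> is only nonnegative on \<open>P\<close>, while
      \<open>pos\<close> asks for positivity. Adding \<open>s *\<^sub>R e\<close> repairs this, and
      \<open>s\<close> is small enough to raise the negative number \<open>d \<bullet> a\<close> by
      at most half its size.\<close>
    define s where "s = - (d \<bullet> a) / (2 * (\<bar>a \<bullet> e\<bar> + 1))"
    have "d \<bullet> a < 0" using d(1) \<open>c < 0\<close> by simp
    then have "0 < s" by (auto simp: s_def divide_neg_pos)
    have "s * (a \<bullet> e) \<le> s * (2 * (\<bar>a \<bullet> e\<bar> + 1)) / 2 " using \<open>0 < s\<close> by simp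
    also have "s * (2 * (\<bar>a \<bullet> e\<bar> + 1)) = - (d \<bullet> a)" by (simp add: s_def)
    finally show False using *[OF \<open>0 < s\<close>] \<open>d \<bullet> a < 0\<close> by (simp add: inner_add_right inner_commute)
  qed
  then obtain c q where q: "q \<in> P" "0 \<le> c" "a = c *\<^sub>R q"
    by (auto simp: C_def conic_hull_explicit)
  with ab(1) have "0 < c" by (cases "c = 0") auto
  have ae: "a \<bullet> e = c" using e[OF q(1)] by (simp add: q(3) inner_commute[of q e])
  have "b \<le> V * c"
  proof (rule field_le_epsilon)
    fix s :: real assume "0 < s"
    show "b \<le> V * c + s"
      using shift[of e "s / c"] e \<open>0 < s\<close> \<open>0 < c\<close> by (simp add: ae)
  qed
  then have "r' \<bullet> q \<le> V" if "r' \<in> K" for r'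
  proof -
    have "c * (r' \<bullet> q) \<le> c * V"
      using ab(2)[OF that] \<open>b \<le> V * c\<close> by (simp add: q(3) inner_commute[of q] mult.commute)
    then show ?thesis using \<open>0 < c\<close> by simp
  qed
  with V[OF q(1)] r(1) have "r \<bullet> q = V" by (simp add: antisym)
  show thesis
    by (rule that[OF r(1) q(1)])
       (use \<open>r \<bullet> q = V\<close> \<open>\<And>r'. r' \<in> K \<Longrightarrow> r' \<bullet> q \<le> V\<close> V in \<open>auto simp: V_def\<close>)
qed

text \<open>Saddle points of a zero-sum game are interchangeable: the \<open>q\<close> of any one of
  them serves every maximin \<open>r\<close>, since all maximin choices guarantee the same
  value.\<close>

lemma maximin_iff_saddle:
  fixes K P :: "'b::euclidean_space set"
  assumes K: "compact K" "convex K" "K \<noteq> {}" and P: "compact P" "convex P" "P \<noteq> {}"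
    and e: "\<And>p. p \<in> P \<Longrightarrow> e \<bullet> p = 1" and r: "r \<in> K"
  shows "(\<forall>r'\<in>K. (INF p\<in>P. r' \<bullet> p) \<le> (INF p\<in>P. r \<bullet> p)) \<longleftrightarrow>
    (\<exists>q\<in>P. (\<forall>r'\<in>K. r' \<bullet> q \<le> r \<bullet> q) \<and> (\<forall>p\<in>P. r \<bullet> q \<le> r \<bullet> p))" (is "?L \<longleftrightarrow> ?R")
proof
  have low: "(INF p\<in>P. r \<bullet> p) \<le> r \<bullet> p" if "p \<in> P" for r p
    by (intro cINF_lower compact_bdd_below_inner P that)
  show ?R if ?L
  proof -
    obtain s q where s: "s \<in> K" "q \<in> P" "\<And>r'. r' \<in> K \<Longrightarrow> r' \<bullet> q \<le> s \<bullet> q"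
      "s \<bullet> q = (INF p\<in>P. s \<bullet> p)"
      using saddle_point_exists[OF K P e] by metis
    have "s \<bullet> q \<le> (INF p\<in>P. r \<bullet> p)" using that s by simp
    then have "s \<bullet> q \<le> r \<bullet> p" if "p \<in> P" for p using low[OF that, of r] by simp
    with s r show ?R by (meson order_trans)
  qed
  show ?L if ?R
  proof -
    from that obtain q where q: "q \<in> P" "\<forall>r'\<in>K. r' \<bullet> q \<le> r \<bullet> q" "\<forall>p\<in>P. r \<bullet> q \<le> r \<bullet> p" by blast
    then have "r \<bullet> q \<le> (INF p\<in>P. r \<bullet> p)" using P by (intro cINF_greatest) auto
    with low[OF q(1)] q(2) show ?L by (meson order_trans)
  qed
qed

section \<open>Payoffs of mixed actions\<close>

lemma finite_pmf_exists:
  assumes "finite I" "\<And>i. i \<in> I \<Longrightarrow> 0 \<le> u i" "sum u I = 1"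
  obtains \<tau> where "set_pmf \<tau> \<subseteq> I" "\<And>i. i \<in> I \<Longrightarrow> pmf \<tau> i = u i"
proof -
  define g where "g i = (if i \<in> I then u i else 0)" for i
  have nonneg: "0 \<le> g i" for i using assms by (simp add: g_def)
  have "(\<integral>\<^sup>+ i. ennreal (g i) \<partial>count_space UNIV) = (\<Sum>i\<in>I. ennreal (g i))"
    by (rule nn_integral_count_space'[OF assms(1)]) (auto simp: g_def)
  also have "\<dots> = ennreal (sum g I)" using nonneg by simp
  also have "sum g I = 1" using assms(3) by (simp add: g_def)
  finally have 1: "(\<integral>\<^sup>+ i. ennreal (g i) \<partial>count_space UNIV) = 1" by simp
  have "pmf (embed_pmf g) i = g i" for i by (rule pmf_embed_pmf[OF nonneg 1])
  then show thesis
    by (intro that[of "embed_pmf g"]) (auto simp: set_pmf_eq g_def split: if_splits)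
qed

locale persuasion =
  fixes A :: "'a::topological_space set"
    and uS uR :: "'a \<Rightarrow> 'w::finite \<Rightarrow> real"
  assumes compact_A: "compact A" and A_nonempty: "A \<noteq> {}"
    and continuous_uS: "\<And>\<omega>. continuous_on A (\<lambda>a. uS a \<omega>)"
    and continuous_uR: "\<And>\<omega>. continuous_on A (\<lambda>a. uR a \<omega>)"
begin

definition pure_payoff :: "'a \<Rightarrow> (real ^ 'w) \<times> (real ^ 'w)" where
  "pure_payoff a = (\<chi> \<omega>. uS a \<omega>, \<chi> \<omega>. uR a \<omega>)"

definition payoff :: "'a measure \<Rightarrow> (real ^ 'w) \<times> (real ^ 'w)" where
  "payoff f = (\<integral>a. pure_payoff a \<partial>f)"

text \<open>This is exactly the range of \<open>payoff\<close> on \<open>strategies A\<close>,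
  written as the hull of a compact set in finite dimension so that its compactness is
  immediate.\<close>

definition payoffs :: "((real ^ 'w) \<times> (real ^ 'w)) set" where
  "payoffs = convex hull (pure_payoff ` A)"

lemma continuous_pure_payoff: "continuous_on A pure_payoff"
  unfolding pure_payoff_def
  by (intro continuous_on_Pair continuous_on_vec_lambda continuous_uS continuous_uR)

lemma compact_payoffs: "compact payoffs"
  unfolding payoffs_def
  by (intro compact_convex_hull compact_continuous_image continuous_pure_payoff compact_A)

lemma convex_payoffs: "convex payoffs"
  by (simp add: payoffs_def)

lemma payoffs_nonempty: "payoffs \<noteq> {}"
  using A_nonempty by (simp add: payoffs_def)

lemma strategy_properties:
  assumes "f \<in> strategies A"
  shows "prob_space f" "space f = A" "integrable f pure_payoff"
proof -
  show prob: "prob_space f" and space: "space f = A"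
    using assms sets_eq_imp_space_eq[of f "restrict_space borel A"]
    by (auto simp: strategies_def space_restrict_space)
  have meas: "pure_payoff \<in> borel_measurable f"
    using borel_measurable_continuous_on_restrict[OF continuous_pure_payoff] assms
    by (auto simp: strategies_def cong: measurable_cong_sets)
  obtain B where "\<And>a. a \<in> A \<Longrightarrow> norm (pure_payoff a) \<le> B"
    using compact_imp_bounded[OF compact_continuous_image[OF continuous_pure_payoff compact_A]]
    by (auto simp: bounded_iff)
  then show "integrable f pure_payoff"
    using prob space meas
    by (intro finite_measure.integrable_const_bound[of f _ B])
       (auto intro: prob_space.finite_measure)
qed

lemma exp_utility_payoff:
  assumes "f \<in> strategies A"
  shows "exp_utility uS f p = fst (payoff f) \<bullet> p" "exp_utility uR f p = snd (payoff f) \<bullet> p"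
proof -
  note int = strategy_properties(3)[OF assms]
  have "fst (payoff f) \<bullet> p = (\<integral>a. fst (pure_payoff a) \<bullet> p \<partial>f)"
    unfolding payoff_def
    by (subst integral_bounded_linear[OF _ int, symmetric])
       (auto intro: bounded_linear_compose[OF bounded_linear_inner_left] bounded_linear_fst)
  then show "exp_utility uS f p = fst (payoff f) \<bullet> p"
    by (simp add: exp_utility_def pure_payoff_def inner_vec_def)
  have "snd (payoff f) \<bullet> p = (\<integral>a. snd (pure_payoff a) \<bullet> p \<partial>f)"
    unfolding payoff_def
    by (subst integral_bounded_linear[OF _ int, symmetric])
       (auto intro: bounded_linear_compose[OF bounded_linear_inner_left] bounded_linear_snd)
  then show "exp_utility uR f p = snd (payoff f) \<bullet> p"
    by (simp add: exp_utility_def pure_payoff_def inner_vec_def)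
qed

text \<open>A functional strictly separating the mean from the hull would exceed \<open>b\<close> at
  all pure payoffs and yet have mean below \<open>b\<close>.\<close>

lemma payoff_in_payoffs:
  assumes "f \<in> strategies A"
  shows "payoff f \<in> payoffs"
proof (rule ccontr)
  assume "payoff f \<notin> payoffs"
  then obtain a b where ab: "a \<bullet> payoff f < b" "\<And>x. x \<in> payoffs \<Longrightarrow> b < a \<bullet> x"
    using separating_hyperplane_closed_point[OF convex_payoffs compact_imp_closed[OF compact_payoffs]]
    by blast
  note f = strategy_properties[OF assms]
  interpret prob_space f by (rule f)
  have "b = (\<integral>x. b \<partial>f)" by (simp add: prob_space)
  also have "\<dots> \<le> (\<integral>x. a \<bullet> pure_payoff x \<partial>f)"
  proof (rule integral_mono)
    fix x assume "x \<in> space f"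
    then have "pure_payoff x \<in> payoffs" using f by (simp add: payoffs_def hull_inc)
    then show "b \<le> a \<bullet> pure_payoff x" using ab(2) by fastforce
  qed (use f in auto)
  also have "\<dots> = a \<bullet> payoff f" unfolding payoff_def using f(3) by simp
  finally show False using ab(1) by simp
qed

lemma payoffs_attained:
  assumes "k \<in> payoffs"
  obtains f where "f \<in> strategies A" "payoff f = k"
proof -
  obtain n :: nat and u x where u: "\<forall>i\<in>{1..n}. 0 \<le> u i \<and> x i \<in> pure_payoff ` A"
    "sum u {1..n} = 1" "(\<Sum>i=1..n. u i *\<^sub>R x i) = k"
    using assms unfolding payoffs_def convex_hull_indexed by blast
  have "\<exists>a. \<forall>i\<in>{1..n}. a i \<in> A \<and> x i = pure_payoff (a i)"
    by (rule bchoice) (use u(1) in auto)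
  then obtain a where a: "\<And>i. i \<in> {1..n} \<Longrightarrow> a i \<in> A \<and> x i = pure_payoff (a i)" by blast
  obtain \<tau> :: "nat pmf" where \<tau>: "set_pmf \<tau> \<subseteq> {1..n}" "\<And>i. i \<in> {1..n} \<Longrightarrow> pmf \<tau> i = u i"
    using finite_pmf_exists[of "{1..n}" u] u by auto
  \<comment> \<open>The choice function \<open>a\<close> is controlled only on
    \<open>{1..n}\<close>; the default \<open>a0\<close> makes \<open>b\<close> map every index into
    \<open>A\<close>, as measurability into the subspace requires.\<close>
  obtain a0 where "a0 \<in> A" using A_nonempty by blast
  define b where "b i = (if i \<in> {1..n} then a i else a0)" for i
  define f where "f = distr (measure_pmf \<tau>) (restrict_space borel A) b"
  have b: "b \<in> measurable (measure_pmf \<tau>) (restrict_space borel A)"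
    using a \<open>a0 \<in> A\<close> by (auto simp: measurable_def b_def space_restrict_space)
  have "f \<in> strategies A"
    unfolding strategies_def f_def
    by (auto intro: prob_space.prob_space_distr[OF prob_space_measure_pmf b])
  moreover have "payoff f = k"
  proof -
    have "payoff f = (\<integral>i. pure_payoff (b i) \<partial>measure_pmf \<tau>)"
      unfolding payoff_def f_def
      by (intro integral_distr b borel_measurable_continuous_on_restrict continuous_pure_payoff)
    also have "\<dots> = (\<Sum>i=1..n. pmf \<tau> i *\<^sub>R pure_payoff (b i))"
      by (rule integral_measure_pmf) (use \<tau> in auto)
    also have "\<dots> = (\<Sum>i=1..n. u i *\<^sub>R x i)"
      using \<tau>(2) a by (intro sum.cong) (auto simp: b_def)
    finally show ?thesis using u(3) by simp
  qed
  ultimately show thesis using that by blast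
qed

end

section \<open>Values of sets of beliefs\<close>

lemma closed_Collect_ball:
  assumes "\<And>k. k \<in> K \<Longrightarrow> closed {x. Q x k}"
  shows "closed {x. \<forall>k\<in>K. Q x k}"
  using assms by (simp add: Collect_ball_eq closed_INT)

lemma belief_inner_one: "p \<in> beliefs \<Longrightarrow> (\<chi> \<omega>. 1) \<bullet> p = 1"
  by (simp add: beliefs_def inner_vec_def)

lemma norm_belief_le: "p \<in> beliefs \<Longrightarrow> norm p \<le> 1"
  using norm_le_l1_cart[of p] by (simp add: beliefs_def)

lemma convex_beliefs: "convex beliefs"
  by (auto simp: convex_def beliefs_def sum.distrib simp flip: sum_distrib_left)

lemma compact_beliefs: "compact beliefs"
proof -
  have "closed (beliefs :: (real ^ 'w::finite) set)"
    unfolding beliefs_def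
    by (intro closed_Collect_conj closed_Collect_all closed_Collect_le closed_Collect_eq
        continuous_intros)
  moreover have "bounded (beliefs :: (real ^ 'w::finite) set)"
    using norm_belief_le by (auto simp: bounded_iff)
  ultimately show ?thesis by (simp add: compact_eq_bounded_closed)
qed

lemma belief_setsD:
  assumes "P \<in> belief_sets"
  shows "compact P" "convex P" "P \<noteq> {}" "P \<subseteq> beliefs"
  using assms bounded_subset[OF compact_imp_bounded[OF compact_beliefs]]
  by (auto simp: belief_sets_def compact_eq_bounded_closed)

lemma segment_belief_set:
  assumes "p \<in> beliefs" "q \<in> beliefs"
  shows "closed_segment p q \<in> belief_sets"
  using assms closed_segment_subset[OF _ _ convex_beliefs] by (auto simp: belief_sets_def)

context persuasion
begin

text \<open>
  These are the conditions under which \<open>(k, q)\<close> is a saddle point for the set of beliefs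
  \<open>closed_segment p q\<close>.
\<close>

definition feasible :: "((real ^ 'w) \<times> ((real ^ 'w) \<times> (real ^ 'w)) \<times> (real ^ 'w)) set" where
  "feasible = {(p, k, q). p \<in> beliefs \<and> k \<in> payoffs \<and> q \<in> beliefs \<and>
     (\<forall>k'\<in>payoffs. snd k' \<bullet> q \<le> snd k \<bullet> q) \<and> snd k \<bullet> q \<le> snd k \<bullet> p}"

lemma compact_feasible: "compact feasible"
proof -
  have "feasible = (beliefs \<times> payoffs \<times> beliefs) \<inter>
      {z. (\<forall>k'\<in>payoffs. snd k' \<bullet> snd (snd z) \<le> snd (fst (snd z)) \<bullet> snd (snd z)) \<and>
        snd (fst (snd z)) \<bullet> snd (snd z) \<le> snd (fst (snd z)) \<bullet> fst z}"
    by (auto simp: feasible_def)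
  moreover have "compact \<dots>"
    by (intro compact_Int_closed compact_Times compact_beliefs compact_payoffs
        closed_Collect_conj closed_Collect_ball closed_Collect_le continuous_intros)
  ultimately show ?thesis by simp
qed

lemma receiver_payoffs: "compact (snd ` payoffs)" "convex (snd ` payoffs)" "snd ` payoffs \<noteq> {}"
  using payoffs_nonempty
  by (simp_all add: compact_continuous_image continuous_intros compact_payoffs
      convex_linear_image linear_snd convex_payoffs)

text \<open>The receiver's utility depends on \<open>f\<close> only through
  \<open>snd (payoff f)\<close>, which ranges over the whole compact convex set \<open>K\<close>;
  this carries the finite-dimensional saddle criterion over to measures.\<close>

lemma best_responses_iff_saddle:
  assumes P: "P \<in> belief_sets"
  shows "f \<in> best_responses A uR P \<longleftrightarrow> f \<in> strategies A \<and>
    (\<exists>q\<in>P. (\<forall>k\<in>payoffs. snd k \<bullet> q \<le> snd (payoff f) \<bullet> q) \<and>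
      (\<forall>p\<in>P. snd (payoff f) \<bullet> q \<le> snd (payoff f) \<bullet> p))"
proof (cases "f \<in> strategies A")
  case True
  define K where "K = snd ` payoffs"
  have K: "compact K" "convex K" "K \<noteq> {}"
    unfolding K_def by (rule receiver_payoffs)+
  have e: "(\<chi> \<omega>. 1) \<bullet> p = 1" if "p \<in> P" for p
    using that belief_setsD(4)[OF P] belief_inner_one by blast
  have K_eq: "K = (\<lambda>f. snd (payoff f)) ` strategies A"
  proof
    show "K \<subseteq> (\<lambda>f. snd (payoff f)) ` strategies A"
    proof
      fix r assume "r \<in> K"
      then obtain k where "k \<in> payoffs" "r = snd k" by (auto simp: K_def)
      then show "r \<in> (\<lambda>f. snd (payoff f)) ` strategies A"
        by (metis payoffs_attained imageI)
    qed
  qed (use payoff_in_payoffs in \<open>auto simp: K_def\<close>)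
  then have "snd (payoff f) \<in> K" using True by blast
  note saddle = maximin_iff_saddle[OF K belief_setsD(1-3)[OF P] e this]
  have "f \<in> best_responses A uR P \<longleftrightarrow>
      (\<forall>f'\<in>strategies A. (INF p\<in>P. exp_utility uR f' p) \<le> (INF p\<in>P. exp_utility uR f p))"
    using True by (auto simp: best_responses_def is_arg_max_def not_less)
  also have "\<dots> \<longleftrightarrow> (\<forall>r'\<in>K. (INF p\<in>P. r' \<bullet> p) \<le> (INF p\<in>P. snd (payoff f) \<bullet> p))"
    using True by (auto simp: K_eq exp_utility_payoff)
  finally show ?thesis using saddle True by (simp add: K_def)
qed (simp add: best_responses_def is_arg_max_def)

text \<open>This makes the \<open>arg_max\<close> in \<open>sender_preferred\<close> a genuine
  maximiser. The witness \<open>q\<close> is kept in \<open>T\<close> because the best-response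
  condition becomes a family of closed inequalities once \<open>q\<close> is a variable.\<close>

lemma sender_utility_attained:
  assumes P: "P \<in> belief_sets"
  shows "\<exists>f\<in>best_responses A uR P. sender_utility A uS uR P p = exp_utility uS f p \<and>
    (\<forall>f'\<in>best_responses A uR P. exp_utility uS f' p \<le> exp_utility uS f p)"
proof -
  note P' = belief_setsD[OF P]
  define T where "T = (payoffs \<times> P) \<inter> {z. (\<forall>k\<in>payoffs. snd k \<bullet> snd z \<le> snd (fst z) \<bullet> snd z) \<and>
     (\<forall>p\<in>P. snd (fst z) \<bullet> snd z \<le> snd (fst z) \<bullet> p)}"
  have "compact T" unfolding T_def
    by (intro compact_Int_closed compact_Times compact_payoffs P'
        closed_Collect_conj closed_Collect_ball closed_Collect_le continuous_intros)
  moreover have "T \<noteq> {}"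
  proof -
    have e: "(\<chi> \<omega>. 1) \<bullet> p = 1" if "p \<in> P" for p
      using that P'(4) belief_inner_one by blast
    obtain r q where rq: "r \<in> snd ` payoffs" "q \<in> P"
      "\<And>r'. r' \<in> snd ` payoffs \<Longrightarrow> r' \<bullet> q \<le> r \<bullet> q" "\<And>p. p \<in> P \<Longrightarrow> r \<bullet> q \<le> r \<bullet> p"
      by (rule saddle_point_exists[OF receiver_payoffs P'(1-3) e]) auto
    then obtain k where k: "k \<in> payoffs" "r = snd k" by blast
    have "(k, q) \<in> T" using k rq by (simp add: T_def)
    then show ?thesis by blast
  qed
  moreover have "continuous_on T (\<lambda>z. fst (fst z) \<bullet> p)" by (intro continuous_intros)
  ultimately obtain z where z: "z \<in> T" "\<And>y. y \<in> T \<Longrightarrow> fst (fst y) \<bullet> p \<le> fst (fst z) \<bullet> p"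
    using continuous_attains_sup[of T "\<lambda>z. fst (fst z) \<bullet> p"] by blast
  have "fst z \<in> payoffs" using z(1) by (auto simp: T_def)
  then obtain f where f: "f \<in> strategies A" "payoff f = fst z" by (rule payoffs_attained)
  have BR: "f' \<in> best_responses A uR P \<longleftrightarrow> f' \<in> strategies A \<and> (\<exists>q. (payoff f', q) \<in> T)" for f'
    using payoff_in_payoffs by (auto simp: best_responses_iff_saddle[OF P] T_def)
  have best: "f \<in> best_responses A uR P"
    "\<And>f'. f' \<in> best_responses A uR P \<Longrightarrow> exp_utility uS f' p \<le> exp_utility uS f p"
  proof -
    have "(payoff f, snd z) \<in> T" using z(1) f(2) by simp
    then show "f \<in> best_responses A uR P" using f(1) BR by blast
    fix f' assume "f' \<in> best_responses A uR P"
    then obtain q where "f' \<in> strategies A" "(payoff f', q) \<in> T" using BR by blast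
    with z(2)[of "(payoff f', q)"] f show "exp_utility uS f' p \<le> exp_utility uS f p"
      by (simp add: exp_utility_payoff)
  qed
  have "is_arg_max (\<lambda>f. exp_utility uS f p) (\<lambda>f. f \<in> best_responses A uR P)
     (sender_preferred A uS uR p P)"
    unfolding sender_preferred_def arg_max_def
    by (rule someI[of _ f]) (simp add: is_arg_max_def best not_less)
  then show ?thesis
    unfolding sender_utility_def is_arg_max_def
    by (intro bexI[of _ "sender_preferred A uS uR p P"]) (auto simp: not_less)
qed

text \<open>Of the whole set \<open>P\<close>, only the saddle witness \<open>q\<close> is
  remembered.\<close>

lemma sender_utility_feasible:
  assumes "P \<in> belief_sets" "p \<in> P"
  obtains k q where "(p, k, q) \<in> feasible" "sender_utility A uS uR P p = fst k \<bullet> p"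
proof -
  obtain f where f: "f \<in> best_responses A uR P" "sender_utility A uS uR P p = exp_utility uS f p"
    using sender_utility_attained[OF assms(1)] by blast
  then obtain q where q: "f \<in> strategies A" "q \<in> P"
    "\<forall>k\<in>payoffs. snd k \<bullet> q \<le> snd (payoff f) \<bullet> q"
    "\<forall>p\<in>P. snd (payoff f) \<bullet> q \<le> snd (payoff f) \<bullet> p"
    unfolding best_responses_iff_saddle[OF assms(1)] by blast
  show thesis
  proof (rule that)
    show "(p, payoff f, q) \<in> feasible"
      using q assms belief_setsD(4)[OF assms(1)] payoff_in_payoffs by (auto simp: feasible_def)
    show "sender_utility A uS uR P p = fst (payoff f) \<bullet> p"
      using f(2) q(1) by (simp add: exp_utility_payoff)
  qed
qed

text \<open>Here \<open>k\<close> is the payoff of a best response to \<open>P\<close>, and the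
  sender-preferred choice can only improve on it. The point \<open>x\<close> is arbitrary because
  the bound is needed at every posterior of a synonym, not just at \<open>p\<close>.\<close>

lemma sender_utility_ge:
  assumes "(p, k, q) \<in> feasible" "P \<in> belief_sets" "q \<in> P"
    and "\<And>p'. p' \<in> P \<Longrightarrow> snd k \<bullet> q \<le> snd k \<bullet> p'"
  shows "fst k \<bullet> x \<le> sender_utility A uS uR P x"
proof -
  have k: "k \<in> payoffs" "\<forall>k'\<in>payoffs. snd k' \<bullet> q \<le> snd k \<bullet> q"
    using assms(1) by (auto simp: feasible_def)
  obtain f where f: "f \<in> strategies A" "payoff f = k" by (rule payoffs_attained[OF k(1)])
  then have "f \<in> best_responses A uR P"
    unfolding best_responses_iff_saddle[OF assms(2)] using k(2) assms(3,4) by blast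
  then show ?thesis
    using sender_utility_attained[OF assms(2), of x] f by (auto simp: exp_utility_payoff)
qed

lemma feasible_segment:
  assumes "(p, k, q) \<in> feasible" "x \<in> closed_segment p q"
  shows "snd k \<bullet> q \<le> snd k \<bullet> x"
proof -
  obtain t where t: "0 \<le> t" "t \<le> 1" "x = (1 - t) *\<^sub>R p + t *\<^sub>R q"
    using assms(2) by (auto simp: in_segment)
  have "(1 - t) * (snd k \<bullet> q) \<le> (1 - t) * (snd k \<bullet> p)"
    using assms(1) t by (intro mult_left_mono) (auto simp: feasible_def)
  then show ?thesis unfolding t(3) by (simp add: inner_add_right algebra_simps)
qed

text \<open>Shrinking a set that contains \<open>p\<close> to the segment from \<open>p\<close> to
  its witness keeps the response optimal, so segments suffice and compactness of
  \<open>feasible\<close> yields a maximum.\<close>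

lemma best_value_feasible:
  assumes "p \<in> beliefs"
  obtains k q where "(p, k, q) \<in> feasible" "best_value A uS uR p = fst k \<bullet> p"
    "\<And>k' q'. (p, k', q') \<in> feasible \<Longrightarrow> fst k' \<bullet> p \<le> fst k \<bullet> p"
    "is_arg_max (\<lambda>P. sender_utility A uS uR P p) (\<lambda>P. P \<in> belief_sets \<and> p \<in> P) (closed_segment p q)"
    "best_value A uS uR p = sender_utility A uS uR (closed_segment p q) p"
proof -
  define T where "T = feasible \<inter> ({p} \<times> UNIV)"
  have "compact T" unfolding T_def
    by (intro compact_Int_closed compact_feasible closed_Times closed_singleton closed_UNIV)
  moreover have "T \<noteq> {}"
  proof -
    obtain k q where "(p, k, q) \<in> feasible"
      by (rule sender_utility_feasible[OF segment_belief_set[OF assms assms], of p]) auto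
    then show ?thesis by (auto simp: T_def)
  qed
  moreover have "continuous_on T (\<lambda>z. fst (fst (snd z)) \<bullet> p)" by (intro continuous_intros)
  ultimately obtain z where z: "z \<in> T"
    "\<And>y. y \<in> T \<Longrightarrow> fst (fst (snd y)) \<bullet> p \<le> fst (fst (snd z)) \<bullet> p"
    using continuous_attains_sup[of T "\<lambda>z. fst (fst (snd z)) \<bullet> p"] by blast
  obtain k q where kq: "z = (p, k, q)" using z(1) by (cases z) (auto simp: T_def)
  have feas: "(p, k, q) \<in> feasible" using z(1) kq by (auto simp: T_def)
  have max: "fst k' \<bullet> p \<le> fst k \<bullet> p" if "(p, k', q') \<in> feasible" for k' q'
    using z(2)[of "(p, k', q')"] that kq by (auto simp: T_def)
  define P where "P = closed_segment p q"
  have P: "P \<in> belief_sets" "p \<in> P" "q \<in> P"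
    using feas by (auto simp: P_def feasible_def intro: segment_belief_set)
  have le: "sender_utility A uS uR P' p \<le> fst k \<bullet> p" if "P' \<in> belief_sets" "p \<in> P'" for P'
    by (rule sender_utility_feasible[OF that]) (simp add: max)
  moreover have "fst k \<bullet> p \<le> sender_utility A uS uR P p"
    by (rule sender_utility_ge[OF feas P(1,3)]) (use feasible_segment[OF feas] in \<open>auto simp: P_def\<close>)
  ultimately have eq: "sender_utility A uS uR P p = fst k \<bullet> p" using P by (simp add: antisym)
  then have "best_value A uS uR p = fst k \<bullet> p"
    unfolding best_value_def
    by (intro cSup_eq_maximum) (use P le in \<open>auto simp flip: eq\<close>)
  moreover have "is_arg_max (\<lambda>P. sender_utility A uS uR P p) (\<lambda>P. P \<in> belief_sets \<and> p \<in> P) P"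
    using P le by (auto simp: is_arg_max_def not_less eq)
  ultimately show thesis
    using eq feas max by (intro that[of k q]) (simp_all only: P_def)
qed

end

section \<open>Ambiguous devices\<close>

text \<open>All coordinates lie in the unit interval, so Tychonoff applies despite the infinitely
  many message coordinates.\<close>

lemma compact_device_set:
  assumes "finite M" "D \<subseteq> devices M" "closed D"
  shows "compact D"
proof -
  define B :: "('a \<Rightarrow> nat \<Rightarrow> real) set" where "B = PiE UNIV (\<lambda>_. PiE UNIV (\<lambda>_. {0..1}))"
  have "compactin (product_topology (\<lambda>_. product_topology (\<lambda>_. euclidean) UNIV) UNIV) B"
    unfolding B_def compactin_PiE by simp
  then have "compact B" by (simp add: euclidean_product_topology)
  moreover have "D \<subseteq> B"
  proof
    fix \<pi> assume "\<pi> \<in> D"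
    then have \<pi>: "\<pi> \<in> devices M" using assms by blast
    have "\<pi> \<omega> m \<le> 1" for \<omega> m
    proof (cases "m \<in> M")
      case True
      then have "\<pi> \<omega> m \<le> (\<Sum>m\<in>M. \<pi> \<omega> m)"
        using \<pi> assms by (intro member_le_sum) (auto simp: devices_def)
      then show ?thesis using \<pi> by (simp add: devices_def)
    qed (use \<pi> in \<open>simp add: devices_def\<close>)
    then show "\<pi> \<in> B" using \<pi> by (auto simp: B_def devices_def)
  qed
  ultimately show ?thesis
    using compact_Int_closed[OF _ \<open>closed D\<close>, of B] by (simp add: inf.absorb2)
qed

lemma message_prob_nonneg:
  assumes "p0 \<in> beliefs" "\<pi> \<in> devices M"
  shows "0 \<le> message_prob p0 \<pi> m"
  using assms by (auto simp: message_prob_def beliefs_def devices_def intro!: sum_nonneg)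

text \<open>In this multiplied form Bayes' rule also holds for unsent messages: there every term of
  the vanishing nonnegative sum is zero.\<close>

lemma scaled_posterior:
  assumes "p0 \<in> beliefs" "\<pi> \<in> devices M"
  shows "message_prob p0 \<pi> m *\<^sub>R posterior p0 \<pi> m = (\<chi> \<omega>. \<pi> \<omega> m * p0 $ \<omega>)"
proof (cases "message_prob p0 \<pi> m = 0")
  case True
  have "\<forall>\<omega>\<in>UNIV. p0 $ \<omega> * \<pi> \<omega> m = 0"
    using True assms unfolding message_prob_def
    by (subst (asm) sum_nonneg_eq_0_iff) (auto simp: beliefs_def devices_def)
  then show ?thesis using True by (auto simp: vec_eq_iff)
qed (simp add: posterior_def vec_eq_iff)

lemma posterior_in_beliefs:
  assumes "p0 \<in> beliefs" "\<pi> \<in> devices M" "0 < message_prob p0 \<pi> m"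
  shows "posterior p0 \<pi> m \<in> beliefs"
proof -
  have "(\<Sum>\<omega>\<in>UNIV. \<pi> \<omega> m * p0 $ \<omega> / message_prob p0 \<pi> m) = 1"
    using assms(3) by (simp add: message_prob_def mult.commute flip: sum_divide_distrib)
  with assms show ?thesis by (auto simp: beliefs_def posterior_def devices_def)
qed

text \<open>Bayes plausibility: the posteriors of a single device average to the prior.\<close>

lemma sum_message_prob:
  assumes "p0 \<in> beliefs" "\<pi> \<in> devices M" "finite M"
  shows "(\<Sum>m | m \<in> M \<and> 0 < message_prob p0 \<pi> m. message_prob p0 \<pi> m) = 1" (is "?A = 1")
    and "(\<Sum>m | m \<in> M \<and> 0 < message_prob p0 \<pi> m. message_prob p0 \<pi> m *\<^sub>R posterior p0 \<pi> m) = p0"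
      (is "?B = p0")
proof -
  have null: "message_prob p0 \<pi> m = 0" if "\<not> 0 < message_prob p0 \<pi> m" for m
    using message_prob_nonneg[OF assms(1,2), of m] that by simp
  have "?A = (\<Sum>m\<in>M. message_prob p0 \<pi> m)"
    using assms(3) null by (intro sum.mono_neutral_left) auto
  also have "\<dots> = (\<Sum>\<omega>\<in>UNIV. p0 $ \<omega> * (\<Sum>m\<in>M. \<pi> \<omega> m))"
    unfolding message_prob_def by (subst sum.swap) (simp add: sum_distrib_left)
  finally show "?A = 1" using assms by (simp add: devices_def beliefs_def)
  have "?B = (\<Sum>m\<in>M. message_prob p0 \<pi> m *\<^sub>R posterior p0 \<pi> m)"
    using assms(3) null by (intro sum.mono_neutral_left) auto
  also have "\<dots> = (\<Sum>m\<in>M. \<chi> \<omega>. \<pi> \<omega> m * p0 $ \<omega>)"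
    by (simp add: scaled_posterior[OF assms(1,2)])
  also have "\<dots> = (\<chi> \<omega>. (\<Sum>m\<in>M. \<pi> \<omega> m) * p0 $ \<omega>)"
    by (simp add: vec_eq_iff sum_distrib_right)
  also have "\<dots> = p0" using assms by (simp add: devices_def vec_eq_iff)
  finally show "?B = p0" .
qed

lemma ambiguous_deviceD:
  assumes "ambiguous_device p0 M D"
  shows "finite M" "D \<noteq> {}" "D \<subseteq> devices M" "closed D"
    and "\<forall>\<pi>\<in>D. \<forall>\<pi>'\<in>D. \<forall>t\<in>{0..1}. (\<lambda>\<omega> m. (1 - t) * \<pi> \<omega> m + t * \<pi>' \<omega> m) \<in> D"
    and "\<forall>\<pi>\<in>D. \<forall>\<pi>'\<in>D. \<forall>m\<in>M. message_prob p0 \<pi> m > 0 \<longleftrightarrow> message_prob p0 \<pi>' m > 0"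
  using assms unfolding ambiguous_device_def by - (elim conjE, assumption)+

lemma ambiguous_device_pos:
  assumes "ambiguous_device p0 M D" "\<pi> \<in> D" "m \<in> M" "0 < message_prob p0 \<pi> m" "\<pi>' \<in> D"
  shows "0 < message_prob p0 \<pi>' m"
  using ambiguous_deviceD(6)[OF assms(1), rule_format, OF assms(2,5,3)] assms(4) by (rule iffD1)

lemma posterior_set_in_belief_sets:
  assumes "p0 \<in> beliefs" and D: "ambiguous_device p0 M D"
    and pos: "\<And>\<pi>. \<pi> \<in> D \<Longrightarrow> 0 < message_prob p0 \<pi> m"
  shows "posterior_set p0 D m \<in> belief_sets"
proof -
  note D' = ambiguous_deviceD(1-4)[OF D]
  note mix = ambiguous_deviceD(5)[OF D, rule_format]
  have coord: "continuous_on D (\<lambda>\<pi>. \<pi> \<omega> m)" for \<omega>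
    by (rule continuous_on_subset[OF continuous_on_product_then_coordinatewise[OF
        continuous_on_product_coordinates]]) simp
  have continuous_on_message_prob: "continuous_on D (\<lambda>\<pi>. message_prob p0 \<pi> m)"
    unfolding message_prob_def by (intro continuous_on_sum continuous_on_mult continuous_on_const coord)
  have "continuous_on D (\<lambda>\<pi>. posterior p0 \<pi> m)"
    unfolding posterior_def using pos
    by (intro continuous_on_vec_lambda continuous_on_divide ballI continuous_on_mult coord
        continuous_on_const continuous_on_message_prob) (metis less_irrefl)
  then have "compact (posterior_set p0 D m)"
    unfolding posterior_set_def by (intro compact_continuous_image compact_device_set[OF D'(1,3,4)])
  moreover have "convex (posterior_set p0 D m)"
    unfolding convex_alt
  proof (intro ballI allI impI)
    fix x y and t :: real
    assume "x \<in> posterior_set p0 D m" "y \<in> posterior_set p0 D m" and t: "0 \<le> t \<and> t \<le> 1"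
    then obtain \<pi> \<pi>' where \<pi>: "\<pi> \<in> D" "x = posterior p0 \<pi> m" and \<pi>': "\<pi>' \<in> D" "y = posterior p0 \<pi>' m"
      by (auto simp: posterior_set_def)
    define a b where "a = message_prob p0 \<pi> m" and "b = message_prob p0 \<pi>' m"
    have ab: "0 < a" "0 < b" using pos \<pi> \<pi>' by (auto simp: a_def b_def)
    define c where "c = t * a + (1 - t) * b"
    have "0 < c" using t ab unfolding c_def
      by (cases "t = 0") (auto intro: add_pos_nonneg)
    \<comment> \<open>Bayes' rule is not affine in the device. In the mixture's posterior,
      \<open>x\<close> and \<open>y\<close> get weights proportional to \<open>(1 - s) * a\<close>
      and \<open>s * b\<close>; this \<open>s\<close> makes them \<open>1 - t\<close> and
      \<open>t\<close>.\<close>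
    define s where "s = t * a / c"
    have s1: "1 - s = (1 - t) * b / c" using \<open>0 < c\<close> by (simp add: s_def field_simps c_def)
    have "s \<in> {0..1}"
      using t ab \<open>0 < c\<close> s1 by (smt (verit) atLeastAtMost_iff divide_nonneg_pos mult_nonneg_nonneg s_def)
    define \<rho> where "\<rho> = (\<lambda>\<omega> m. (1 - s) * \<pi> \<omega> m + s * \<pi>' \<omega> m)"
    have "\<rho> \<in> D" unfolding \<rho>_def by (rule mix) fact+
    have "message_prob p0 \<rho> m = (1 - s) * a + s * b"
      by (simp add: message_prob_def \<rho>_def a_def b_def algebra_simps sum.distrib sum_distrib_left
          sum_subtractf)
    also have "\<dots> = a * b / c" unfolding s1 unfolding s_def using \<open>0 < c\<close>
      by (simp add: field_simps)
    finally have \<rho>m: "message_prob p0 \<rho> m = a * b / c" .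
    have "(1 - t) *\<^sub>R x + t *\<^sub>R y = posterior p0 \<rho> m"
    proof (rule vec_eq_iff[THEN iffD2], rule allI)
      fix \<omega>
      have "posterior p0 \<rho> m $ \<omega> = ((1 - t) * b / c * \<pi> \<omega> m + t * a / c * \<pi>' \<omega> m) * p0 $ \<omega> / (a * b / c)"
        unfolding posterior_def \<rho>m by (simp add: \<rho>_def s1) (simp add: s_def)
      also have "\<dots> = (1 - t) * (\<pi> \<omega> m * p0 $ \<omega> / a) + t * (\<pi>' \<omega> m * p0 $ \<omega> / b)"
        using ab \<open>0 < c\<close> by (simp add: field_simps)
      finally show "((1 - t) *\<^sub>R x + t *\<^sub>R y) $ \<omega> = posterior p0 \<rho> m $ \<omega>"
        by (simp add: \<pi> \<pi>' posterior_def a_def b_def)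
    qed
    then show "(1 - t) *\<^sub>R x + t *\<^sub>R y \<in> posterior_set p0 D m"
      using \<open>\<rho> \<in> D\<close> by (simp add: posterior_set_def)
  qed
  moreover have "posterior_set p0 D m \<subseteq> beliefs"
    using posterior_in_beliefs[OF assms(1) _ pos] D' by (auto simp: posterior_set_def)
  ultimately show ?thesis
    using D' by (auto simp: belief_sets_def posterior_set_def compact_imp_closed)
qed

section \<open>Upper bound: devices as convex combinations of attainable values\<close>

context persuasion
begin

text \<open>The graph of \<open>best_value\<close> need not be closed, as \<open>best_value\<close>
  can jump where the receiver switches actions. Keeping all feasible values, not only the largest
  one, gives a compact set with \<open>best_value\<close> as its upper boundary.\<close>

definition value_graph :: "((real ^ 'w) \<times> real) set" where
  "value_graph = (\<lambda>(p, k, q). (p, fst k \<bullet> p)) ` feasible"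

lemma compact_value_graph: "compact value_graph"
  unfolding value_graph_def case_prod_unfold
  by (intro compact_continuous_image compact_feasible continuous_intros)

lemma best_value_in_value_graph:
  assumes "p \<in> beliefs"
  shows "(p, best_value A uS uR p) \<in> value_graph"
proof -
  obtain k q where "(p, k, q) \<in> feasible" "best_value A uS uR p = fst k \<bullet> p"
    by (rule best_value_feasible[OF assms])
  then show ?thesis by (force simp: value_graph_def)
qed

lemma best_value_ge:
  assumes "(p, y) \<in> value_graph"
  shows "y \<le> best_value A uS uR p"
proof -
  obtain k q where kq: "(p, k, q) \<in> feasible" "y = fst k \<bullet> p"
    using assms by (auto simp: value_graph_def)
  then have "p \<in> beliefs" by (simp add: feasible_def)
  then show ?thesis by (rule best_value_feasible) (metis kq)
qed

lemma sender_utility_in_value_graph: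
  assumes "P \<in> belief_sets" "p \<in> P"
  shows "(p, sender_utility A uS uR P p) \<in> value_graph"
proof -
  obtain k q where "(p, k, q) \<in> feasible" "sender_utility A uS uR P p = fst k \<bullet> p"
    by (rule sender_utility_feasible[OF assms])
  then show ?thesis by (force simp: value_graph_def)
qed

text \<open>The message probabilities of \<open>\<pi>\<close> serve as convex weights. Common
  support makes each posterior set of a sent message a legitimate member of
  \<open>belief_sets\<close>.\<close>

lemma device_payoff_in_hull:
  assumes p0: "p0 \<in> beliefs" and D: "ambiguous_device p0 M D" and \<pi>: "\<pi> \<in> D"
  shows "(p0, \<Sum>m | m \<in> M \<and> message_prob p0 \<pi> m > 0. message_prob p0 \<pi> m *
      sender_utility A uS uR (posterior_set p0 D m) (posterior p0 \<pi> m)) \<in> convex hull value_graph"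
    (is "(p0, ?y) \<in> _")
proof -
  define M' where "M' = {m. m \<in> M \<and> message_prob p0 \<pi> m > 0}"
  define x where "x m = (posterior p0 \<pi> m,
      sender_utility A uS uR (posterior_set p0 D m) (posterior p0 \<pi> m))" for m
  have D': "finite M" "\<pi> \<in> devices M" using ambiguous_deviceD(1,3)[OF D] \<pi> by auto
  have "x m \<in> convex hull value_graph" if "m \<in> M'" for m
    unfolding x_def
  proof (intro hull_inc sender_utility_in_value_graph posterior_set_in_belief_sets[OF p0 D])
    show "0 < message_prob p0 \<pi>' m" if "\<pi>' \<in> D" for \<pi>'
      using ambiguous_device_pos[OF D \<pi> _ _ that] \<open>m \<in> M'\<close> by (simp add: M'_def)
  qed (use \<pi> in \<open>simp add: posterior_set_def\<close>)
  then have "(\<Sum>m\<in>M'. message_prob p0 \<pi> m *\<^sub>R x m) \<in> convex hull value_graph"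
    using D' sum_message_prob(1)[OF p0 D'(2,1)]
    by (intro convex_sum convex_convex_hull) (auto simp: M'_def)
  also have "(\<Sum>m\<in>M'. message_prob p0 \<pi> m *\<^sub>R x m) = (p0, ?y)"
    using sum_message_prob(2)[OF p0 D'(2,1)]
    by (intro prod_eqI) (simp_all add: fst_sum snd_sum x_def M'_def)
  finally show ?thesis .
qed

lemma sender_utility_bounded:
  "\<exists>C\<ge>0. (\<forall>P\<in>belief_sets. \<forall>p\<in>P. \<bar>sender_utility A uS uR P p\<bar> \<le> C) \<and>
    (\<forall>k\<in>payoffs. \<forall>p\<in>beliefs. \<bar>fst k \<bullet> p\<bar> \<le> C)"
proof -
  obtain C where C: "\<And>k. k \<in> payoffs \<Longrightarrow> norm k \<le> C"
    using compact_imp_bounded[OF compact_payoffs] by (auto simp: bounded_iff)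
  have "0 \<le> C" using C payoffs_nonempty norm_ge_zero order_trans by (metis equals0I)
  have *: "\<bar>fst k \<bullet> p\<bar> \<le> C" if "k \<in> payoffs" "p \<in> beliefs" for k p
  proof -
    have "\<bar>fst k \<bullet> p\<bar> \<le> norm (fst k) * norm p" by (rule Cauchy_Schwarz_ineq2)
    also have "\<dots> \<le> C * 1"
      using norm_fst_le[of "fst k" "snd k"] C[OF that(1)] norm_belief_le[OF that(2)] \<open>0 \<le> C\<close>
      by (intro mult_mono) (auto intro: order_trans)
    finally show ?thesis by simp
  qed
  have "\<bar>sender_utility A uS uR P p\<bar> \<le> C" if "P \<in> belief_sets" "p \<in> P" for P p
    by (rule sender_utility_feasible[OF that]) (simp add: feasible_def *)
  with * \<open>0 \<le> C\<close> show ?thesis by blast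
qed

lemma device_value_le:
  assumes p0: "p0 \<in> beliefs" and D: "ambiguous_device p0 M D"
    and y: "\<And>z. (p0, z) \<in> convex hull value_graph \<Longrightarrow> z \<le> y"
  shows "device_value A uS uR p0 M D \<le> y"
proof -
  define val where "val \<pi> = (\<Sum>m | m \<in> M \<and> message_prob p0 \<pi> m > 0. message_prob p0 \<pi> m *
      sender_utility A uS uR (posterior_set p0 D m) (posterior p0 \<pi> m))" for \<pi>
  have hull: "(p0, val \<pi>) \<in> convex hull value_graph" if "\<pi> \<in> D" for \<pi>
    unfolding val_def by (rule device_payoff_in_hull[OF p0 D that])
  have "bounded (snd ` (convex hull value_graph))"
    by (intro bounded_snd compact_imp_bounded compact_convex_hull compact_value_graph)
  moreover have "val ` D \<subseteq> snd ` (convex hull value_graph)" using hull by force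
  ultimately have "bdd_below (val ` D)" by (metis bounded_subset bounded_imp_bdd_below)
  moreover obtain \<pi> where \<pi>: "\<pi> \<in> D" using ambiguous_deviceD(2)[OF D] by blast
  ultimately have "(INF \<pi>\<in>D. val \<pi>) \<le> val \<pi>" by (rule cINF_lower)
  also have "\<dots> \<le> y" by (rule y[OF hull[OF \<pi>]])
  finally show ?thesis by (simp add: device_value_def val_def)
qed

end

section \<open>Construction of nearly optimal ambiguous devices\<close>

text \<open>
  A family \<open>z\<close> of nonnegative vectors with sum \<open>p0\<close> is the joint distribution of state and message
  of the following device.
\<close>

definition joint_device :: "real ^ 'w::finite \<Rightarrow> (nat \<Rightarrow> real ^ 'w) \<Rightarrow> 'w \<Rightarrow> nat \<Rightarrow> real" where
  "joint_device p0 z \<omega> m = z m $ \<omega> / p0 $ \<omega>"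

lemma joint_device_in_devices:
  assumes "\<And>\<omega>. 0 < p0 $ \<omega>" "\<And>m \<omega>. 0 \<le> z m $ \<omega>" "\<And>m. m \<notin> M \<Longrightarrow> z m = 0"
    and "(\<Sum>m\<in>M. z m) = p0"
  shows "joint_device p0 z \<in> devices M"
proof -
  have "(\<Sum>m\<in>M. z m $ \<omega>) = p0 $ \<omega>" for \<omega>
    using assms(4) by (metis sum_component)
  then have "(\<Sum>m\<in>M. z m $ \<omega> / p0 $ \<omega>) = 1" for \<omega>
    using assms(1)[of \<omega>] by (simp flip: sum_divide_distrib)
  then show ?thesis
    using assms(1-3) by (auto simp: devices_def joint_device_def less_imp_le)
qed

lemma message_prob_joint_device:
  assumes "\<And>\<omega>. 0 < p0 $ \<omega>"
  shows "message_prob p0 (joint_device p0 z) m = (\<chi> \<omega>. 1) \<bullet> z m"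
  using assms[THEN less_imp_neq] by (auto simp: message_prob_def joint_device_def inner_vec_def intro!: sum.cong)

lemma posterior_joint_device:
  assumes "\<And>\<omega>. 0 < p0 $ \<omega>"
  shows "posterior p0 (joint_device p0 z) m = z m /\<^sub>R ((\<chi> \<omega>. 1) \<bullet> z m)"
  unfolding posterior_def message_prob_joint_device[OF assms]
  using assms[THEN less_imp_neq] by (auto simp: joint_device_def vec_eq_iff divide_inverse)

text \<open>With the prior fixed, \<open>joint_device\<close> is linear in the joint distribution,
  so an affine path of joint distributions gives a segment of devices, closed as a continuous image
  of a compact interval.\<close>

lemma ambiguous_device_segment:
  fixes z :: "real \<Rightarrow> nat \<Rightarrow> real ^ 'w::finite"
  assumes p0: "\<And>\<omega>. 0 < p0 $ \<omega>" and "finite M"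
    and z: "\<And>t m \<omega>. t \<in> {0..1} \<Longrightarrow> 0 \<le> z t m $ \<omega>" "\<And>t m. m \<notin> M \<Longrightarrow> z t m = 0"
    and sum: "\<And>t. (\<Sum>m\<in>M. z t m) = p0"
    and affine: "\<And>t m. z t m = (1 - t) *\<^sub>R z 0 m + t *\<^sub>R z 1 m"
    and supp: "\<And>t t' m. t \<in> {0..1} \<Longrightarrow> t' \<in> {0..1} \<Longrightarrow> m \<in> M \<Longrightarrow>
      0 < (\<chi> \<omega>. 1) \<bullet> z t m \<Longrightarrow> 0 < (\<chi> \<omega>. 1) \<bullet> z t' m"
  shows "ambiguous_device p0 M ((\<lambda>t. joint_device p0 (z t)) ` {0..1})" (is "ambiguous_device p0 M ?D")
  unfolding ambiguous_device_def
proof (intro conjI)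
  show "?D \<subseteq> devices M"
    using joint_device_in_devices[OF p0 z sum] by blast
  have cont: "continuous_on {0..1} (\<lambda>t. z t m $ \<omega> / p0 $ \<omega>)" for m \<omega>
    by (subst affine) (use p0[of \<omega>] in \<open>auto intro!: continuous_intros\<close>)
  have "continuous_on {0..1} (\<lambda>t. joint_device p0 (z t))"
    unfolding joint_device_def by (intro continuous_on_coordinatewise_then_product cont)
  then have "compact ?D" by (intro compact_continuous_image compact_Icc)
  then show "closed ?D" by (rule compact_imp_closed)
  show "\<forall>\<pi>\<in>?D. \<forall>\<pi>'\<in>?D. \<forall>s\<in>{0..1}. (\<lambda>\<omega> m. (1 - s) * \<pi> \<omega> m + s * \<pi>' \<omega> m) \<in> ?D"
  proof (intro ballI, elim imageE)
    fix \<pi> \<pi>' and s t t' :: real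
    assume *: "s \<in> {0..1}" "t \<in> {0..1}" "t' \<in> {0..1}"
      and \<pi>: "\<pi> = joint_device p0 (z t)" "\<pi>' = joint_device p0 (z t')"
    define r where "r = (1 - s) * t + s * t'"
    have "r \<in> {0..1}"
      using * convexD_alt[OF convex_real_interval(5)[of 0 1], of t t' s] by (simp add: r_def)
    moreover have "z r m = (1 - s) *\<^sub>R z t m + s *\<^sub>R z t' m" for m
      unfolding affine[of r m] affine[of t m] affine[of t' m]
      by (simp add: r_def vec_eq_iff algebra_simps)
    then have "(\<lambda>\<omega> m. (1 - s) * \<pi> \<omega> m + s * \<pi>' \<omega> m) = joint_device p0 (z r)"
      unfolding \<pi> by (intro ext) (simp add: joint_device_def add_divide_distrib)
    ultimately show "(\<lambda>\<omega> m. (1 - s) * \<pi> \<omega> m + s * \<pi>' \<omega> m) \<in> ?D" by blast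
  qed
  show "\<forall>\<pi>\<in>?D. \<forall>\<pi>'\<in>?D. \<forall>m\<in>M. 0 < message_prob p0 \<pi> m \<longleftrightarrow> 0 < message_prob p0 \<pi>' m"
  proof (intro ballI, elim imageE)
    fix \<pi> \<pi>' and m and t t' :: real
    assume "m \<in> M" "t \<in> {0..1}" "t' \<in> {0..1}"
      and \<pi>: "\<pi> = joint_device p0 (z t)" "\<pi>' = joint_device p0 (z t')"
    then show "0 < message_prob p0 \<pi> m \<longleftrightarrow> 0 < message_prob p0 \<pi>' m"
      unfolding \<pi> message_prob_joint_device[OF p0] using supp[of t t' m] supp[of t' t m] by blast
  qed
qed (use \<open>finite M\<close> in auto)

context persuasion
begin

text \<open>
  The synonyms of the \<open>i\<close>-th posterior are the messages \<open>2 * i\<close> and \<open>2 * i + 1\<close>. Giving \<open>q i\<close> a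
  small probability changes the average posterior; full support of \<open>p0\<close> leaves room to correct this
  with the small remaining mass, which is sent as message \<open>0\<close> in all devices. Message \<open>1\<close> is never
  sent.
\<close>

lemma approximating_device:
  fixes n :: nat
  assumes p0: "p0 \<in> beliefs" "\<And>\<omega>. 0 < p0 $ \<omega>"
    and u: "\<And>i. i \<in> {1..n} \<Longrightarrow> 0 \<le> u i" "sum u {1..n} = 1"
    and feas: "\<And>i. i \<in> {1..n} \<Longrightarrow> (p i, k i, q i) \<in> feasible"
    and bary: "(\<Sum>i=1..n. u i *\<^sub>R p i) = p0"
    and C: "0 \<le> C" "\<And>P p. P \<in> belief_sets \<Longrightarrow> p \<in> P \<Longrightarrow> \<bar>sender_utility A uS uR P p\<bar> \<le> C"
      "\<And>k p. k \<in> payoffs \<Longrightarrow> p \<in> beliefs \<Longrightarrow> \<bar>fst k \<bullet> p\<bar> \<le> C"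
    and \<epsilon>: "0 < \<epsilon>" "\<epsilon> < 1"
  shows "\<exists>M D. ambiguous_device p0 M D \<and>
    (\<Sum>i=1..n. u i * (fst (k i) \<bullet> p i)) - 3 * C * \<epsilon> \<le> device_value A uS uR p0 M D"
proof -
  define \<mu> where "\<mu> = Min (range (($) p0))"
  have \<mu>: "0 < \<mu>" "\<And>\<omega>. \<mu> \<le> p0 $ \<omega>" using p0(2) by (simp_all add: \<mu>_def)
  have "\<mu> \<le> 1"
    using \<mu>(2)[of undefined] p0(1) member_le_sum[of undefined UNIV "($) p0"] by (auto simp: beliefs_def)
  \<comment> \<open>Each coordinate of the average of the \<open>q i\<close> is at most
    \<open>1\<close>, so \<open>\<eta> = \<epsilon> * \<mu>\<close> keeps its contribution below
    \<open>\<epsilon> * p0 $ \<omega>\<close>; this is what makes \<open>rest\<close>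
    nonnegative.\<close>
  define \<eta> where "\<eta> = \<epsilon> * \<mu>"
  have \<eta>: "0 < \<eta>" "\<eta> \<le> \<epsilon>" using \<epsilon> \<mu> \<open>\<mu> \<le> 1\<close> by (auto simp: \<eta>_def mult_le_cancel_left1)
  define one :: "real ^ 'w" where "one = (\<chi> \<omega>. 1)"
  have pq: "p i \<in> beliefs" "q i \<in> beliefs" "k i \<in> payoffs" "snd (k i) \<bullet> q i \<le> snd (k i) \<bullet> p i"
    if "i \<in> {1..n}" for i
    using feas[OF that] by (auto simp: feasible_def)
  have one: "one \<bullet> p i = 1" "one \<bullet> q i = 1" if "i \<in> {1..n}" for i
    using pq[OF that] by (simp_all add: one_def belief_inner_one)
  define rest where "rest = p0 - (\<Sum>i=1..n. u i *\<^sub>R (\<eta> *\<^sub>R q i + (1 - \<epsilon>) *\<^sub>R p i))"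
  have "(\<Sum>i=1..n. u i *\<^sub>R (\<eta> *\<^sub>R q i + (1 - \<epsilon>) *\<^sub>R p i)) =
      \<eta> *\<^sub>R (\<Sum>i=1..n. u i *\<^sub>R q i) + (1 - \<epsilon>) *\<^sub>R p0"
    unfolding bary[symmetric]
    by (simp add: scaleR_right_distrib sum.distrib scaleR_sum_right mult.commute)
  then have rest_eq: "rest = \<epsilon> *\<^sub>R p0 - \<eta> *\<^sub>R (\<Sum>i=1..n. u i *\<^sub>R q i)"
    by (simp add: rest_def scaleR_left_diff_distrib)
  have sumq: "(\<Sum>i=1..n. u i *\<^sub>R q i) \<in> beliefs"
    by (intro convex_sum convex_beliefs) (use u pq in auto)
  have rest_nonneg: "0 \<le> rest $ \<omega>" for \<omega>
  proof -
    have "(\<Sum>i=1..n. u i *\<^sub>R q i) $ \<omega> \<le> 1"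
      using sumq member_le_sum[of \<omega> UNIV "($) (\<Sum>i=1..n. u i *\<^sub>R q i)"] by (auto simp: beliefs_def)
    then have "\<eta> * ((\<Sum>i=1..n. u i *\<^sub>R q i) $ \<omega>) \<le> \<eta>" using \<eta> by simp
    also have "\<dots> \<le> \<epsilon> * p0 $ \<omega>" using \<mu>(2) \<epsilon> by (simp add: \<eta>_def)
    finally show ?thesis unfolding rest_eq by simp
  qed
  have one_rest: "one \<bullet> rest = \<epsilon> - \<eta>"
    unfolding rest_eq using belief_inner_one[OF p0(1)] belief_inner_one[OF sumq]
    by (simp add: one_def inner_diff_right)
  \<comment> \<open>The weight of \<open>p i\<close> in message \<open>m\<close>. At
    \<open>t = 0\<close> the even synonym carries \<open>q i\<close> and the odd one
    \<open>p i\<close>, at \<open>t = 1\<close> the roles are exchanged; the weights of the two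
    synonyms always add up to \<open>1\<close>.\<close>
  define c :: "real \<Rightarrow> nat \<Rightarrow> real" where "c t m = (if even m then t else 1 - t)" for t m
  define M where "M = {..Suc (2 * n)}"
  define z where "z t m = (if m = 0 then rest else if m \<notin> M \<or> m = 1 then 0 else
    (u (m div 2) * (1 - c t m) * \<eta>) *\<^sub>R q (m div 2) + (u (m div 2) * c t m * (1 - \<epsilon>)) *\<^sub>R p (m div 2))"
    for t m
  have c01: "0 \<le> c t m" "c t m \<le> 1" if "t \<in> {0..1}" for t m
    using that by (auto simp: c_def)
  have split_M: "(\<Sum>m\<in>M. g m) = g 0 + g 1 + (\<Sum>i=1..n. g (2 * i) + g (Suc (2 * i)))" for g :: "nat \<Rightarrow> 'x::comm_monoid_add"
    unfolding M_def sum.in_pairs_0 by (simp add: sum.atMost_shift sum.atLeast1_atMost_eq lessThan_Suc_atMost)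
  have idx: "m div 2 \<in> {1..n}" if "m \<in> M" "m \<noteq> 0" "m \<noteq> 1" for m
    using that by (auto simp: M_def)
  have z_msg: "z t m = (u (m div 2) * (1 - c t m) * \<eta>) *\<^sub>R q (m div 2) +
      (u (m div 2) * c t m * (1 - \<epsilon>)) *\<^sub>R p (m div 2)" if "m \<in> M" "m \<noteq> 0" "m \<noteq> 1" for t m
    using that by (simp add: z_def)
  have z_pair: "z t (2 * i) + z t (Suc (2 * i)) = u i *\<^sub>R (\<eta> *\<^sub>R q i + (1 - \<epsilon>) *\<^sub>R p i)"
    if "i \<in> {1..n}" for t i
    using that by (simp add: z_def M_def c_def vec_eq_iff algebra_simps)
  have sum_z: "(\<Sum>m\<in>M. z t m) = p0" for t
  proof -
    have "(\<Sum>m\<in>M. z t m) = z t 0 + z t 1 + (\<Sum>i=1..n. z t (2 * i) + z t (Suc (2 * i)))"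
      by (rule split_M)
    also have "(\<Sum>i=1..n. z t (2 * i) + z t (Suc (2 * i))) =
        (\<Sum>i=1..n. u i *\<^sub>R (\<eta> *\<^sub>R q i + (1 - \<epsilon>) *\<^sub>R p i))"
      by (intro sum.cong refl z_pair)
    finally show ?thesis by (simp add: z_def rest_def)
  qed
  have one_z: "one \<bullet> z t m = u (m div 2) * ((1 - c t m) * \<eta> + c t m * (1 - \<epsilon>))"
    if "m \<in> M" "m \<noteq> 0" "m \<noteq> 1" for t m
    using one[OF idx[OF that]] by (simp add: z_msg[OF that] inner_add_right algebra_simps)
  have mix_pos: "0 < (1 - c t m) * \<eta> + c t m * (1 - \<epsilon>)" if "t \<in> {0..1}" for t m
    using c01[OF that, of m] \<eta> \<epsilon> by (cases "c t m = 0") (auto intro: add_nonneg_pos)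
  have pos_iff: "0 < one \<bullet> z t m \<longleftrightarrow> 0 < u (m div 2)" if "m \<in> M" "m \<noteq> 0" "m \<noteq> 1" "t \<in> {0..1}" for t m
    using mix_pos[OF that(4), of m] by (simp add: one_z[OF that(1-3)] zero_less_mult_iff)
  define D where "D = (\<lambda>t. joint_device p0 (z t)) ` {0..1}"
  have D: "ambiguous_device p0 M D"
    unfolding D_def
  proof (rule ambiguous_device_segment[OF p0(2)])
    show "finite M" by (simp add: M_def)
    show "0 \<le> z t m $ \<omega>" if "t \<in> {0..1}" for t m \<omega>
    proof (cases "m \<in> M \<and> m \<noteq> 0 \<and> m \<noteq> 1")
      case True
      then have "i \<in> {1..n}" if "i = m div 2" for i using idx that by blast
      then show ?thesis
        using True c01[OF that, of m] \<eta> \<epsilon> u(1)[of "m div 2"] pq(1,2)[of "m div 2"]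
        by (auto simp: z_msg beliefs_def intro!: add_nonneg_nonneg mult_nonneg_nonneg)
    qed (use rest_nonneg in \<open>auto simp: z_def\<close>)
    show "z t m = 0" if "m \<notin> M" for t m using that by (auto simp: z_def M_def)
    show "z t m = (1 - t) *\<^sub>R z 0 m + t *\<^sub>R z 1 m" for t m
      by (simp add: z_def c_def vec_eq_iff algebra_simps)
    show "0 < (\<chi> \<omega>. 1) \<bullet> z t' m" if "t \<in> {0..1}" "t' \<in> {0..1}" "m \<in> M" "0 < (\<chi> \<omega>. 1) \<bullet> z t m" for t t' m
    proof (cases "m = 0 \<or> m = 1")
      case False
      then show ?thesis using that pos_iff unfolding one_def by metis
    qed (use that in \<open>auto simp: z_def\<close>)
  qed (rule sum_z)
  define S where "S = (\<Sum>i=1..n. u i * (fst (k i) \<bullet> p i))"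
  \<comment> \<open>A lower bound for the contribution of message \<open>m\<close>: message
    \<open>0\<close> has mass at most \<open>\<epsilon>\<close> and costs at most \<open>C\<close>
    per unit, while after a synonym the response \<open>k\<close> is available and its payoff is
    linear in the joint mass, which cancels the normalisation of the posterior.\<close>
  define low where "low t m = (if m = 0 then - (C * \<epsilon>) else if m = 1 then 0 else fst (k (m div 2)) \<bullet> z t m)" for t m
  have mp: "message_prob p0 (joint_device p0 (z t)) m = one \<bullet> z t m" for t m
    by (simp add: message_prob_joint_device[OF p0(2)] one_def)
  have low_le: "low t m \<le> one \<bullet> z t m *
      sender_utility A uS uR (posterior_set p0 D m) (posterior p0 (joint_device p0 (z t)) m)"
    if t: "t \<in> {0..1}" and m: "m \<in> M" "0 < one \<bullet> z t m" for t m
  proof -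
    let ?P = "posterior_set p0 D m" and ?x = "posterior p0 (joint_device p0 (z t)) m"
    have P: "?P \<in> belief_sets"
    proof (rule posterior_set_in_belief_sets[OF p0(1) D])
      show "0 < message_prob p0 \<pi> m" if "\<pi> \<in> D" for \<pi>
        using ambiguous_device_pos[OF D _ m(1) _ that, of "joint_device p0 (z t)"] m(2) t
        by (simp add: mp D_def)
    qed
    have x: "?x \<in> ?P" using t by (simp add: posterior_set_def D_def)
    consider "m = 0" | "m = 1" | "m \<noteq> 0" "m \<noteq> 1" by blast
    then show ?thesis
    proof cases
      case 1
      have "- C \<le> sender_utility A uS uR ?P ?x" using C(2)[OF P x] by simp
      then have "one \<bullet> z t m * - C \<le> one \<bullet> z t m * sender_utility A uS uR ?P ?x"
        using m(2) by (intro mult_left_mono) auto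
      moreover have "C * (one \<bullet> z t m) \<le> C * \<epsilon>"
        using 1 \<eta> C(1) by (intro mult_left_mono) (simp_all add: z_def one_rest)
      ultimately show ?thesis using 1 by (simp add: low_def mult.commute)
    next
      case 2
      then show ?thesis using m(2) by (simp add: z_def)
    next
      case 3
      define i where "i = m div 2"
      have i: "i \<in> {1..n}" using idx[OF m(1) 3] by (simp add: i_def)
      have ui: "0 < u i" using pos_iff[OF m(1) 3 t] m(2) by (simp add: i_def)
      \<comment> \<open>The endpoint of the segment of devices at which message \<open>m\<close> has
        posterior exactly \<open>q i\<close>; this places the saddle witness in the posterior
        set.\<close>
      define s where "s = (if even m then 0 else 1 :: real)"
      have s: "s \<in> {0..1}" "c s m = 0" by (auto simp: s_def c_def)
      define d where "d = u i * \<eta>"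
      have "z s m = d *\<^sub>R q i" using s by (simp add: z_msg[OF m(1) 3] d_def i_def)
      moreover have "d \<noteq> 0" using ui \<eta> by (simp add: d_def)
      ultimately have "posterior p0 (joint_device p0 (z s)) m = q i"
        unfolding posterior_joint_device[OF p0(2)] one_def[symmetric] using one[OF i] by simp
      then have qP: "q i \<in> ?P" using s by (force simp: posterior_set_def D_def)
      have "snd (k i) \<bullet> q i \<le> snd (k i) \<bullet> y" if "y \<in> ?P" for y
      proof -
        from that obtain t' where t': "t' \<in> {0..1}" "y = posterior p0 (joint_device p0 (z t')) m"
          by (auto simp: posterior_set_def D_def)
        \<comment> \<open>Every other posterior after \<open>m\<close> is a weighted average of
          \<open>q i\<close> and \<open>p i\<close>, so the saddle inequality passes to it by
          linearity.\<close>
        define a b where "a = u i * (1 - c t' m) * \<eta>" and "b = u i * c t' m * (1 - \<epsilon>)"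
        have ab: "0 \<le> a" "0 \<le> b" using c01[OF t'(1), of m] ui \<eta> \<epsilon> by (auto simp: a_def b_def)
        have zab: "z t' m = a *\<^sub>R q i + b *\<^sub>R p i"
          unfolding z_msg[OF m(1) 3] by (simp add: a_def b_def i_def)
        have "0 < one \<bullet> z t' m" using pos_iff[OF m(1) 3 t'(1)] ui by (simp add: i_def)
        then have "0 < a + b" using one[OF i] by (simp add: zab inner_add_right)
        have "y = (a *\<^sub>R q i + b *\<^sub>R p i) /\<^sub>R (a + b)"
          unfolding t'(2) posterior_joint_device[OF p0(2)] one_def[symmetric] zab
          using one[OF i] by (simp add: inner_add_right)
        then have "snd (k i) \<bullet> y = (a * (snd (k i) \<bullet> q i) + b * (snd (k i) \<bullet> p i)) / (a + b)"
          by (simp add: inner_add_right divide_inverse mult.commute)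
        moreover have "(a + b) * (snd (k i) \<bullet> q i) \<le> a * (snd (k i) \<bullet> q i) + b * (snd (k i) \<bullet> p i)"
          using mult_left_mono[OF pq(4)[OF i] ab(2)] by (simp add: distrib_right)
        ultimately show ?thesis using \<open>0 < a + b\<close> by (simp add: pos_le_divide_eq mult.commute)
      qed
      then have "fst (k i) \<bullet> ?x \<le> sender_utility A uS uR ?P ?x"
        by (intro sender_utility_ge[OF feas[OF i] P qP])
      then have "one \<bullet> z t m * (fst (k i) \<bullet> ?x) \<le> one \<bullet> z t m * sender_utility A uS uR ?P ?x"
        using m(2) by (intro mult_left_mono) auto
      moreover have "one \<bullet> z t m * (fst (k i) \<bullet> ?x) = fst (k i) \<bullet> z t m"
        unfolding posterior_joint_device[OF p0(2)] one_def[symmetric] using m(2) by simp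
      ultimately show ?thesis using 3 by (simp add: low_def i_def)
    qed
  qed
  have low_null: "low t m \<le> 0" if "t \<in> {0..1}" "m \<in> M" "\<not> 0 < one \<bullet> z t m" for t m
  proof (cases "m = 0 \<or> m = 1")
    case False
    then have "u (m div 2) = 0" using pos_iff[of m t] u(1)[OF idx[of m]] that by force
    then show ?thesis using False that by (simp add: low_def z_msg)
  qed (use C(1) \<epsilon> in \<open>auto simp: low_def\<close>)
  \<comment> \<open>One loss of \<open>C * \<epsilon>\<close> comes from message \<open>0\<close>,
    one from scaling \<open>S\<close> by \<open>1 - \<epsilon>\<close>, and one from the mass
    \<open>\<eta> \<le> \<epsilon>\<close> on the \<open>q i\<close>. The sum over a pair of
    synonyms does not depend on \<open>t\<close>.\<close>
  have sum_low: "S - 3 * C * \<epsilon> \<le> (\<Sum>m\<in>M. low t m)" for t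
  proof -
    have "S \<le> (\<Sum>i=1..n. u i * C)" unfolding S_def
      using C(3)[OF pq(3,1)] u(1) by (intro sum_mono mult_left_mono) (auto dest: abs_le_D1)
    then have "\<epsilon> * S \<le> \<epsilon> * C" using u(2) \<epsilon> by (simp flip: sum_distrib_right)
    have "- C = (\<Sum>i=1..n. u i * - C)" using u(2) by (simp flip: sum_distrib_right add: sum_negf)
    also have "\<dots> \<le> (\<Sum>i=1..n. u i * (fst (k i) \<bullet> q i))"
      using C(3)[OF pq(3,2)] u(1) by (intro sum_mono mult_left_mono) (auto simp: abs_le_iff minus_le_iff)
    finally have "\<eta> * - C \<le> \<eta> * (\<Sum>i=1..n. u i * (fst (k i) \<bullet> q i))" using \<eta> by (intro mult_left_mono) auto
    moreover have "\<eta> * C \<le> \<epsilon> * C" using \<eta> C(1) by (intro mult_right_mono) auto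
    moreover have "(\<Sum>m\<in>M. low t m) = - (C * \<epsilon>) + (\<Sum>i=1..n. low t (2 * i) + low t (Suc (2 * i)))"
      unfolding split_M by (simp add: low_def)
    moreover have "(\<Sum>i=1..n. low t (2 * i) + low t (Suc (2 * i))) =
        (\<Sum>i=1..n. u i * (\<eta> * (fst (k i) \<bullet> q i) + (1 - \<epsilon>) * (fst (k i) \<bullet> p i)))"
    proof (rule sum.cong)
      fix i assume i: "i \<in> {1..n}"
      then have "low t (2 * i) + low t (Suc (2 * i)) = fst (k i) \<bullet> (z t (2 * i) + z t (Suc (2 * i)))"
        by (simp add: low_def inner_add_right)
      then show "low t (2 * i) + low t (Suc (2 * i)) =
          u i * (\<eta> * (fst (k i) \<bullet> q i) + (1 - \<epsilon>) * (fst (k i) \<bullet> p i))"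
        unfolding z_pair[OF i] by (simp add: inner_add_right)
    qed simp
    moreover have "\<dots> = \<eta> * (\<Sum>i=1..n. u i * (fst (k i) \<bullet> q i)) + (1 - \<epsilon>) * S"
      unfolding S_def by (simp add: distrib_left sum.distrib sum_distrib_left mult_ac)
    ultimately show ?thesis using \<open>\<epsilon> * S \<le> \<epsilon> * C\<close> by (simp add: algebra_simps)
  qed
  have "S - 3 * C * \<epsilon> \<le> device_value A uS uR p0 M D"
    unfolding device_value_def
  proof (rule cINF_greatest)
    show "D \<noteq> {}" by (rule ambiguous_deviceD(2)[OF D])
    fix \<pi> assume "\<pi> \<in> D"
    then obtain t where t: "t \<in> {0..1}" "\<pi> = joint_device p0 (z t)" by (auto simp: D_def)
    note sum_low[of t]
    also have "(\<Sum>m\<in>M. low t m) \<le> (\<Sum>m | m \<in> M \<and> 0 < one \<bullet> z t m. low t m)"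
    proof -
      have "(\<Sum>m\<in>M. low t m) \<le> (\<Sum>m\<in>M. if 0 < one \<bullet> z t m then low t m else 0)"
        using low_null[OF t(1)] by (intro sum_mono) auto
      moreover have "finite M" by (simp add: M_def)
      ultimately show ?thesis by (simp only: sum.inter_filter)
    qed
    also have "\<dots> \<le> (\<Sum>m | m \<in> M \<and> 0 < one \<bullet> z t m. one \<bullet> z t m *
        sender_utility A uS uR (posterior_set p0 D m) (posterior p0 (joint_device p0 (z t)) m))"
      using low_le[OF t(1)] by (intro sum_mono) auto
    finally show "S - 3 * C * \<epsilon> \<le> (\<Sum>m | m \<in> M \<and> message_prob p0 \<pi> m > 0. message_prob p0 \<pi> m *
        sender_utility A uS uR (posterior_set p0 D m) (posterior p0 \<pi> m))"
      unfolding t(2) mp .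
  qed
  with D show ?thesis unfolding S_def by blast
qed

section \<open>Both optimal values equal the height of the hull above the prior\<close>

lemma optimal_ambiguous_value_eq:
  assumes p0: "p0 \<in> beliefs" "\<And>\<omega>. 0 < p0 $ \<omega>"
    and y: "(p0, y) \<in> convex hull value_graph" "\<And>z. (p0, z) \<in> convex hull value_graph \<Longrightarrow> z \<le> y"
  shows "optimal_ambiguous_value A uS uR p0 = y"
proof -
  obtain C where C: "0 \<le> C" "\<And>P p. P \<in> belief_sets \<Longrightarrow> p \<in> P \<Longrightarrow> \<bar>sender_utility A uS uR P p\<bar> \<le> C"
    "\<And>k p. k \<in> payoffs \<Longrightarrow> p \<in> beliefs \<Longrightarrow> \<bar>fst k \<bullet> p\<bar> \<le> C"
    using sender_utility_bounded by blast
  obtain n :: nat and u x where ux: "\<And>i. i \<in> {1..n} \<Longrightarrow> 0 \<le> u i \<and> x i \<in> value_graph"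
    "sum u {1..n} = 1" "(\<Sum>i=1..n. u i *\<^sub>R x i) = (p0, y)"
    using y(1) unfolding convex_hull_indexed by blast
  have "\<exists>w. \<forall>i\<in>{1..n}. w i \<in> feasible \<and> x i = (fst (w i), fst (fst (snd (w i))) \<bullet> fst (w i))"
    by (rule bchoice) (use ux(1) in \<open>force simp: value_graph_def\<close>)
  then obtain w where w: "\<And>i. i \<in> {1..n} \<Longrightarrow> w i \<in> feasible"
    "\<And>i. i \<in> {1..n} \<Longrightarrow> x i = (fst (w i), fst (fst (snd (w i))) \<bullet> fst (w i))" by blast
  have "(\<Sum>i=1..n. u i *\<^sub>R fst (w i)) = fst (\<Sum>i=1..n. u i *\<^sub>R x i)"
    unfolding fst_sum using w(2) by (intro sum.cong) auto
  then have bary: "(\<Sum>i=1..n. u i *\<^sub>R fst (w i)) = p0" by (simp only: ux(3) fst_conv snd_conv)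
  have "(\<Sum>i=1..n. u i * (fst (fst (snd (w i))) \<bullet> fst (w i))) = snd (\<Sum>i=1..n. u i *\<^sub>R x i)"
    unfolding snd_sum using w(2) by (intro sum.cong) auto
  then have val: "(\<Sum>i=1..n. u i * (fst (fst (snd (w i))) \<bullet> fst (w i))) = y" by (simp only: ux(3) fst_conv snd_conv)
  define V where "V = {device_value A uS uR p0 M D | M D. ambiguous_device p0 M D}"
  have approx: "\<exists>v\<in>V. y - 3 * C * \<epsilon> \<le> v" if \<epsilon>: "0 < \<epsilon>" "\<epsilon> < 1" for \<epsilon>
    using approximating_device[of p0 n u "\<lambda>i. fst (w i)" "\<lambda>i. fst (snd (w i))" "\<lambda>i. snd (snd (w i))" C,
        OF p0 _ ux(2) _ bary C \<epsilon>] ux(1) w(1) unfolding val V_def by auto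
  have upper: "v \<le> y" if "v \<in> V" for v
    using that device_value_le[OF p0(1) _ y(2)] by (auto simp: V_def)
  have least: "y \<le> b" if b: "\<And>v. v \<in> V \<Longrightarrow> v \<le> b" for b
  proof (rule field_le_epsilon)
    fix e :: real assume "0 < e"
    \<comment> \<open>Chosen so that \<open>3 * C * \<epsilon> \<le> e\<close>; the added
      \<open>1\<close> keeps the denominator positive when \<open>C = 0\<close>.\<close>
    define \<epsilon> where "\<epsilon> = min (1 / 2) (e / (3 * C + 1))"
    have "0 < \<epsilon>" "\<epsilon> < 1" using \<open>0 < e\<close> C(1) by (auto simp: \<epsilon>_def)
    then obtain v where "v \<in> V" "y - 3 * C * \<epsilon> \<le> v" using approx by blast
    moreover have "3 * C * \<epsilon> \<le> (3 * C + 1) * (e / (3 * C + 1))"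
      using C(1) \<open>0 < \<epsilon>\<close> by (intro mult_mono) (auto simp: \<epsilon>_def)
    ultimately show "y \<le> b + e" using b[of v] C(1) by simp
  qed
  have "V \<noteq> {}" using approx[of "1 / 2"] by auto
  then show ?thesis
    unfolding optimal_ambiguous_value_def V_def[symmetric]
    by (rule cSup_eq_non_empty[OF _ upper least])
qed

text \<open>The points that represent \<open>(p0, y)\<close> may lie below
  \<open>best_value\<close>; raising them to it gives the expectation of a splitting, which cannot
  exceed \<open>y\<close>, so equality follows.\<close>

lemma optimal_splitting:
  assumes p0: "p0 \<in> beliefs"
    and y: "(p0, y) \<in> convex hull value_graph" "\<And>z. (p0, z) \<in> convex hull value_graph \<Longrightarrow> z \<le> y"
  obtains \<tau> where "\<tau> \<in> splittings p0" "measure_pmf.expectation \<tau> (best_value A uS uR) = y"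
    "\<And>\<tau>'. \<tau>' \<in> splittings p0 \<Longrightarrow> measure_pmf.expectation \<tau>' (best_value A uS uR) \<le> y"
proof -
  have le: "measure_pmf.expectation \<tau> (best_value A uS uR) \<le> y" if "\<tau> \<in> splittings p0" for \<tau>
  proof -
    have \<tau>: "finite (set_pmf \<tau>)" "set_pmf \<tau> \<subseteq> beliefs" "(\<Sum>p\<in>set_pmf \<tau>. pmf \<tau> p *\<^sub>R p) = p0"
      using that by (auto simp: splittings_def)
    have E: "measure_pmf.expectation \<tau> (best_value A uS uR) =
        (\<Sum>p\<in>set_pmf \<tau>. pmf \<tau> p *\<^sub>R best_value A uS uR p)"
      by (rule integral_measure_pmf[OF \<tau>(1)])
    have "(\<Sum>p\<in>set_pmf \<tau>. pmf \<tau> p *\<^sub>R (p, best_value A uS uR p)) \<in> convex hull value_graph"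
      using \<tau> by (intro convex_sum convex_convex_hull hull_inc best_value_in_value_graph)
        (auto simp: sum_pmf_eq_1)
    also have "(\<Sum>p\<in>set_pmf \<tau>. pmf \<tau> p *\<^sub>R (p, best_value A uS uR p)) =
        (p0, measure_pmf.expectation \<tau> (best_value A uS uR))"
      by (intro prod_eqI) (simp_all add: fst_sum snd_sum \<tau>(3) E)
    finally show ?thesis by (rule y(2))
  qed
  obtain n :: nat and u x where ux: "\<And>i. i \<in> {1..n} \<Longrightarrow> 0 \<le> u i \<and> x i \<in> value_graph"
    "sum u {1..n} = 1" "(\<Sum>i=1..n. u i *\<^sub>R x i) = (p0, y)"
    using y(1) unfolding convex_hull_indexed by blast
  obtain \<sigma> where \<sigma>: "set_pmf \<sigma> \<subseteq> {1..n}" "\<And>i. i \<in> {1..n} \<Longrightarrow> pmf \<sigma> i = u i"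
    using finite_pmf_exists[of "{1..n}" u] ux(1,2) by auto
  \<comment> \<open>Different indices may share a posterior. The pushforward merges them, and
    computing with expectations over \<open>\<sigma>\<close> avoids collecting their weights by
    hand.\<close>
  define \<tau> where "\<tau> = map_pmf (\<lambda>i. fst (x i)) \<sigma>"
  have fin: "finite (set_pmf \<tau>)"
    using finite_subset[OF \<sigma>(1)] by (simp add: \<tau>_def)
  have E\<tau>: "measure_pmf.expectation \<tau> g = (\<Sum>i=1..n. u i *\<^sub>R g (fst (x i)))" for g :: "_ \<Rightarrow> 'x::euclidean_space"
  proof -
    have "measure_pmf.expectation \<tau> g = (\<Sum>i=1..n. pmf \<sigma> i *\<^sub>R g (fst (x i)))"
      unfolding \<tau>_def integral_map_pmf by (rule integral_measure_pmf) (use \<sigma>(1) in auto)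
    then show ?thesis using \<sigma>(2) by simp
  qed
  have "(\<Sum>p\<in>set_pmf \<tau>. pmf \<tau> p *\<^sub>R p) = measure_pmf.expectation \<tau> (\<lambda>p. p)"
    by (rule integral_measure_pmf[OF fin, symmetric])
  also have "\<dots> = fst (\<Sum>i=1..n. u i *\<^sub>R x i)" by (simp add: E\<tau> fst_sum)
  also have "\<dots> = p0" by (simp only: ux(3) fst_conv snd_conv)
  finally have "(\<Sum>p\<in>set_pmf \<tau>. pmf \<tau> p *\<^sub>R p) = p0" .
  moreover have "set_pmf \<tau> \<subseteq> beliefs"
    using \<sigma>(1) ux(1) by (fastforce simp: \<tau>_def value_graph_def feasible_def)
  ultimately have \<tau>: "\<tau> \<in> splittings p0" using fin by (simp add: splittings_def)
  have "y = snd (\<Sum>i=1..n. u i *\<^sub>R x i)" by (simp only: ux(3) fst_conv snd_conv)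
  also have "\<dots> = (\<Sum>i=1..n. u i * snd (x i))" by (simp add: snd_sum)
  also have "\<dots> \<le> (\<Sum>i=1..n. u i * best_value A uS uR (fst (x i)))"
    using ux(1) by (intro sum_mono mult_left_mono best_value_ge) auto
  finally have "measure_pmf.expectation \<tau> (best_value A uS uR) = y"
    using le[OF \<tau>] by (simp add: E\<tau>)
  with \<tau> le show thesis by (intro that)
qed

text \<open>The vertical slice of the compact hull above \<open>p0\<close> is compact, and the
  unsplit prior shows that it is nonempty.\<close>

lemma concave_envelope_attained:
  assumes "p0 \<in> beliefs"
  obtains y where "(p0, y) \<in> convex hull value_graph"
    "\<And>z. (p0, z) \<in> convex hull value_graph \<Longrightarrow> z \<le> y"
proof -
  define F where "F = (convex hull value_graph) \<inter> ({p0} \<times> UNIV)"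
  have "compact F" unfolding F_def
    by (intro compact_Int_closed compact_convex_hull compact_value_graph closed_Times
        closed_singleton closed_UNIV)
  moreover have "(p0, best_value A uS uR p0) \<in> F"
    unfolding F_def using best_value_in_value_graph[OF assms] by (simp add: hull_inc)
  ultimately obtain z where z: "z \<in> F" "\<And>y. y \<in> F \<Longrightarrow> snd y \<le> snd z"
    using continuous_attains_sup[of F snd] continuous_on_snd[OF continuous_on_id] by blast
  show thesis
  proof (rule that)
    show "(p0, snd z) \<in> convex hull value_graph" using z(1) by (auto simp: F_def)
    show "y \<le> snd z" if "(p0, y) \<in> convex hull value_graph" for y
      using z(2)[of "(p0, y)"] that by (simp add: F_def)
  qed
qed

end

theorem corollary2p2:
  fixes A :: "'a::topological_space set"
    and uS uR :: "'a \<Rightarrow> 'w::finite \<Rightarrow> real"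
    and p0 :: "real ^ 'w"
  assumes "compact A" and "A \<noteq> {}"
    and "\<And>\<omega>. continuous_on A (\<lambda>a. uS a \<omega>)"
    and "\<And>\<omega>. continuous_on A (\<lambda>a. uR a \<omega>)"
    and "p0 \<in> beliefs" and "\<And>\<omega>. 0 < p0 $ \<omega>"
  shows "(\<forall>p\<in>beliefs. \<exists>P.
            is_arg_max (\<lambda>P. sender_utility A uS uR P p) (\<lambda>P. P \<in> belief_sets \<and> p \<in> P) P \<and>
            best_value A uS uR p = sender_utility A uS uR P p) \<and>
         (\<exists>\<tau>. is_arg_max (\<lambda>\<tau>. measure_pmf.expectation \<tau> (best_value A uS uR))
                 (\<lambda>\<tau>. \<tau> \<in> splittings p0) \<tau> \<and>
            optimal_ambiguous_value A uS uR p0 =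
              measure_pmf.expectation \<tau> (best_value A uS uR))"
proof -
  interpret persuasion A uS uR
    by unfold_locales (use assms in auto)
  obtain y where y: "(p0, y) \<in> convex hull value_graph"
    "\<And>z. (p0, z) \<in> convex hull value_graph \<Longrightarrow> z \<le> y"
    using concave_envelope_attained[OF assms(5)] by metis
  obtain \<tau> where \<tau>: "\<tau> \<in> splittings p0" "measure_pmf.expectation \<tau> (best_value A uS uR) = y"
    "\<And>\<tau>'. \<tau>' \<in> splittings p0 \<Longrightarrow> measure_pmf.expectation \<tau>' (best_value A uS uR) \<le> y"
    using optimal_splitting[OF assms(5) y] by metis
  show ?thesis
  proof (intro conjI ballI exI[of _ \<tau>])
    fix p :: "real ^ 'w" assume "p \<in> beliefs"
    then show "\<exists>P. is_arg_max (\<lambda>P. sender_utility A uS uR P p) (\<lambda>P. P \<in> belief_sets \<and> p \<in> P) P \<and>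
        best_value A uS uR p = sender_utility A uS uR P p"
      by (rule best_value_feasible) blast
  next
    show "is_arg_max (\<lambda>\<tau>. measure_pmf.expectation \<tau> (best_value A uS uR)) (\<lambda>\<tau>. \<tau> \<in> splittings p0) \<tau>"
      using \<tau> by (auto simp: is_arg_max_def not_less)
    show "optimal_ambiguous_value A uS uR p0 = measure_pmf.expectation \<tau> (best_value A uS uR)"
      using optimal_ambiguous_value_eq[OF assms(5,6) y] \<tau>(2) by simp
  qed
qed

end
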